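(* Let $Q$ be a finite quiver without loops or oriented 2-cycles, with vertex set $Q_0=\{1,\ldots,n\}$, and let $\mathcal{A}_Q$ be the associated cluster algebra with initial cluster $(x_1,\ldots,x_n)$. If $Q$ has at least one pair of vertices $j,k\in Q_0$ with an odd number of arrows between them, then there exist specialisation relations $\sigma$ (assigning values in $\{1,-1\}$ to some of the initial cluster variables) such that the specialised cluster algebra $\mathcal{A}_Q|_\sigma$ is polyamorous and the set of its variables $\{x_{j_1},\ldots,x_{j_\ell}\}$ is nonempty. Moreover, $\mathcal{A}_Q|_\sigma=\mathbb{Z}[x_{j_1},\ldots,x_{j_\ell}]$.
   Context: Cluster algebra. Let $Q$ be a finite quiver (multiple arrows allowed) without loops or oriented 2-cycles and with vertices $1,\ldots,n$. A seed is a quiver on the vertex set $\{1,\ldots,n\}$ together with a cluster, i.e. an $n$-tuple of elements of $\mathbb{Q}(x_1,\ldots,x_n)$; the initial seed is $Q$ with the initial cluster $(x_1,\ldots,x_n)$. The mutation $\mu_j$ of a seed changes the quiver as follows: all arrows incident to $j$ are reversed, every directed 2-path with central vertex $j$ is completed to an oriented triangle, and then oriented 2-cycles are removed (standard Fomin–Zelevinsky quiver mutation). It replaces the $j$-th cluster variable $x_j$ of the seed by $x_j'=\bigl(\prod_{i\to j}x_i+\prod_{j\to i}x_i\bigr)/x_j$, where the products run over the arrows into $j$ and out of $j$ in the quiver of the seed (with multiplicity), and leaves the other cluster variables unchanged. $\mathcal{A}_Q$ is the $\mathbb{Z}$-algebra generated by all cluster variables in all clusters obtained from the initial seed by finite sequences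 of mutations. By the Laurent phenomenon, $\mathcal{A}_Q\subset\mathbb{Z}[x_1^{\pm1},\ldots,x_n^{\pm1}]$. Specialisation. Specialisation relations $\sigma$ assign to each variable in some subset of the initial cluster variables a value in $\{1,-1\}$. The specialised cluster algebra $\mathcal{A}_Q|_\sigma$ is the image of $\mathcal{A}_Q$ under the ring homomorphism from $\mathbb{Z}[x_1^{\pm1},\ldots,x_n^{\pm1}]$ to the ring of Laurent polynomials over $\mathbb{Z}$ in the non-specialised initial cluster variables given by substituting the assigned values. The non-specialised initial cluster variables are called the variables of $\mathcal{A}_Q|_\sigma$. Polyamorous. A variable $x_j$ of $\mathcal{A}_Q|_\sigma$ is polyamorous if every element of $\mathcal{A}_Q|_\sigma$ is polynomial in $x_j$, i.e. contains no negative powers of $x_j$. The algebra $\mathcal{A}_Q|_\sigma$ is polyamorous if all its variables are polyamorous. *)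

theory Defs
  imports
    "HOL-Library.Poly_Mapping"
    "HOL-Computational_Algebra.Computational_Algebra"
begin

text \<open>A quiver on the vertices \<open>1, \<dots>, n\<close> is given by its arrow multiplicities:
  \<open>q i j\<close> is the number of arrows from \<open>i\<close> to \<open>j\<close>.\<close>

type_synonym quiver = "nat \<Rightarrow> nat \<Rightarrow> nat"

definition is_quiver :: "nat \<Rightarrow> quiver \<Rightarrow> bool" where
  "is_quiver n q \<longleftrightarrow>
     (\<forall>i j. q i j \<noteq> 0 \<longrightarrow> i \<in> {1..n} \<and> j \<in> {1..n}) \<and>
     (\<forall>i. q i i = 0) \<and>
     (\<forall>i j. q i j = 0 \<or> q j i = 0)"

text \<open>The arrows before the cancellation of oriented 2-cycles: those incident to \<open>j\<close> are
  reversed, and each path \<open>i \<rightarrow> j \<rightarrow> k\<close> contributes an arrow \<open>i \<rightarrow> k\<close>, which forms an oriented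
  triangle with the reversed arrows \<open>k \<rightarrow> j \<rightarrow> i\<close>.\<close>

definition pre_mutate :: "nat \<Rightarrow> quiver \<Rightarrow> quiver" where
  "pre_mutate j q i k = (if i = j \<or> k = j then q k i else q i k + q i j * q j k)"

text \<open>Removing a maximal set of oriented 2-cycles is truncated subtraction of multiplicities.\<close>

definition mutate_quiver :: "nat \<Rightarrow> quiver \<Rightarrow> quiver" where
  "mutate_quiver j q i k = pre_mutate j q i k - pre_mutate j q k i"

text \<open>Integral Laurent polynomials, as finitely supported integer coefficients on finitely
  supported integer exponent vectors. The variables are indexed by all natural numbers, but only
  those with index in \<open>{1..n}\<close> occur below. The fraction field of the Laurent polynomials in
  \<open>x\<^sub>1, \<dots>, x\<^sub>n\<close> over the integers is the field of rational functions in \<open>x\<^sub>1, \<dots>, x\<^sub>n\<close> over the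
  rationals.\<close>

type_synonym laurent = "(nat \<Rightarrow>\<^sub>0 int) \<Rightarrow>\<^sub>0 int"
type_synonym ratfun = "laurent fract"

definition var_power :: "nat \<Rightarrow> int \<Rightarrow> laurent" where
  "var_power i k = Poly_Mapping.single (Poly_Mapping.single i k) 1"

abbreviation var :: "nat \<Rightarrow> laurent" where
  "var i \<equiv> var_power i 1"

type_synonym seed = "quiver \<times> (nat \<Rightarrow> ratfun)"

definition mutate_seed :: "nat \<Rightarrow> nat \<Rightarrow> seed \<Rightarrow> seed" where
  "mutate_seed n j s = (case s of (q, c) \<Rightarrow>
     (mutate_quiver j q,
      c(j := ((\<Prod>i\<in>{1..n}. c i ^ q i j) + (\<Prod>i\<in>{1..n}. c i ^ q j i)) / c j)))"

inductive_set seeds :: "nat \<Rightarrow> quiver \<Rightarrow> seed set" for n :: nat and Q :: quiver where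
  initial: "(Q, \<lambda>i. to_fract (var i)) \<in> seeds n Q"
| mutation: "s \<in> seeds n Q \<Longrightarrow> j \<in> {1..n} \<Longrightarrow> mutate_seed n j s \<in> seeds n Q"

inductive_set subring_generated :: "'a::comm_ring_1 set \<Rightarrow> 'a set" for S :: "'a set" where
  base: "a \<in> S \<Longrightarrow> a \<in> subring_generated S"
| one: "1 \<in> subring_generated S"
| diff: "a \<in> subring_generated S \<Longrightarrow> b \<in> subring_generated S \<Longrightarrow> a - b \<in> subring_generated S"
| mult: "a \<in> subring_generated S \<Longrightarrow> b \<in> subring_generated S \<Longrightarrow> a * b \<in> subring_generated S"

definition cluster_algebra :: "nat \<Rightarrow> quiver \<Rightarrow> ratfun set" where
  "cluster_algebra n Q = subring_generated {c i | q c i. (q, c) \<in> seeds n Q \<and> i \<in> {1..n}}"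

text \<open>The partial map \<open>\<sigma>\<close> gives the value of \<open>x\<^sub>i\<close> for each \<open>i\<close> in its domain.\<close>

definition is_specialisation :: "nat \<Rightarrow> (nat \<rightharpoonup> int) \<Rightarrow> bool" where
  "is_specialisation n \<sigma> \<longleftrightarrow> dom \<sigma> \<subseteq> {1..n} \<and> ran \<sigma> \<subseteq> {1, -1}"

text \<open>The image of \<open>x\<^sub>i\<close> to the power \<open>k\<close>. The values are \<open>1\<close> or \<open>-1\<close>, hence their own inverses,
  so that powers with negative exponents may be computed with \<open>\<bar>k\<bar>\<close>.\<close>

definition specialise_power :: "(nat \<rightharpoonup> int) \<Rightarrow> nat \<Rightarrow> int \<Rightarrow> laurent" where
  "specialise_power \<sigma> i k = (case \<sigma> i of None \<Rightarrow> var_power i k | Some c \<Rightarrow> of_int c ^ nat \<bar>k\<bar>)"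

definition specialise :: "(nat \<rightharpoonup> int) \<Rightarrow> laurent \<Rightarrow> laurent" where
  "specialise \<sigma> p =
     (\<Sum>m\<in>Poly_Mapping.keys p. of_int (Poly_Mapping.lookup p m) *
        (\<Prod>i\<in>Poly_Mapping.keys m. specialise_power \<sigma> i (Poly_Mapping.lookup m i)))"

text \<open>The preimage under \<open>to_fract\<close> views the cluster algebra as a set of Laurent polynomials; no
  element is lost, by the Laurent phenomenon.\<close>

definition specialised_cluster_algebra :: "nat \<Rightarrow> quiver \<Rightarrow> (nat \<rightharpoonup> int) \<Rightarrow> laurent set" where
  "specialised_cluster_algebra n Q \<sigma> = specialise \<sigma> ` (to_fract -` cluster_algebra n Q)"

definition free_indices :: "nat \<Rightarrow> (nat \<rightharpoonup> int) \<Rightarrow> nat set" where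
  "free_indices n \<sigma> = {1..n} - dom \<sigma>"

definition polyamorous_var :: "nat \<Rightarrow> quiver \<Rightarrow> (nat \<rightharpoonup> int) \<Rightarrow> nat \<Rightarrow> bool" where
  "polyamorous_var n Q \<sigma> j \<longleftrightarrow>
     (\<forall>p \<in> specialised_cluster_algebra n Q \<sigma>. \<forall>m \<in> Poly_Mapping.keys p.
        0 \<le> Poly_Mapping.lookup m j)"

definition polyamorous :: "nat \<Rightarrow> quiver \<Rightarrow> (nat \<rightharpoonup> int) \<Rightarrow> bool" where
  "polyamorous n Q \<sigma> \<longleftrightarrow> (\<forall>j \<in> free_indices n \<sigma>. polyamorous_var n Q \<sigma> j)"

end

theory Submission
  imports Defs
begin

text \<open>
  Leave a single variable \<open>x\<^sub>j\<close> free, send \<open>x\<^sub>k\<close> to \<open>-1\<close> and all other variables to \<open>1\<close>, where the number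
  of arrows between \<open>j\<close> and \<open>k\<close> is odd. Then the exchange polynomial \<open>P\<^sub>j\<close> specialises to \<open>0\<close>. By the
  Laurent phenomenon for the initial cluster and its neighbour in direction \<open>j\<close>, every element of the
  cluster algebra is a polynomial in \<open>x\<^sub>j\<close> and \<open>P\<^sub>j / x\<^sub>j\<close> over the Laurent polynomials in the other
  variables, so it specialises to a polynomial in \<open>x\<^sub>j\<close>.

  The Laurent phenomenon follows the upper bounds of Berenstein, Fomin and Zelevinsky: the ring of
  all elements that are Laurent in the initial cluster and in all its neighbours is invariant under
  mutation. This needs the exchange polynomials at non-adjacent vertices to be coprime. Adding a
  frozen vertex for every vertex gives the exchange matrix full rank, which is preserved by mutation
  and yields a grading for which one of the two polynomials is homogeneous, while the two terms of
  the other have different degrees. At the end the frozen variables are set to \<open>1\<close>.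
\<close>

abbreviation keys :: "('a \<Rightarrow>\<^sub>0 'b::zero) \<Rightarrow> 'a set" where
  "keys \<equiv> Poly_Mapping.keys"

abbreviation lookup :: "('a \<Rightarrow>\<^sub>0 'b::zero) \<Rightarrow> 'a \<Rightarrow> 'b" where
  "lookup \<equiv> Poly_Mapping.lookup"

section \<open>Subrings and ring homomorphisms\<close>

definition is_subring :: "'a::comm_ring_1 set \<Rightarrow> bool" where
  "is_subring S \<longleftrightarrow> 1 \<in> S \<and> (\<forall>a\<in>S. \<forall>b\<in>S. a - b \<in> S \<and> a * b \<in> S)"

context
  fixes S :: "'a::comm_ring_1 set"
  assumes S: "is_subring S"
begin

lemma is_subring_one: "1 \<in> S"
  and is_subring_diff: "a \<in> S \<Longrightarrow> b \<in> S \<Longrightarrow> a - b \<in> S"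
  and is_subring_mult: "a \<in> S \<Longrightarrow> b \<in> S \<Longrightarrow> a * b \<in> S"
  using S by (auto simp: is_subring_def)

lemma is_subring_zero: "0 \<in> S"
  using is_subring_diff[OF is_subring_one is_subring_one] by simp

lemma is_subring_minus: "a \<in> S \<Longrightarrow> - a \<in> S"
  using is_subring_diff[OF is_subring_zero] by fastforce

lemma is_subring_add: "a \<in> S \<Longrightarrow> b \<in> S \<Longrightarrow> a + b \<in> S"
  using is_subring_diff[OF _ is_subring_minus] by fastforce

lemma is_subring_sum: "(\<And>i. i \<in> A \<Longrightarrow> f i \<in> S) \<Longrightarrow> sum f A \<in> S"
  by (induction A rule: infinite_finite_induct) (auto intro: is_subring_zero is_subring_add)

lemma is_subring_prod: "(\<And>i. i \<in> A \<Longrightarrow> f i \<in> S) \<Longrightarrow> prod f A \<in> S"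
  by (induction A rule: infinite_finite_induct) (auto intro: is_subring_one is_subring_mult)

lemma is_subring_power: "a \<in> S \<Longrightarrow> a ^ k \<in> S"
  by (induction k) (auto intro: is_subring_one is_subring_mult)

lemma is_subring_of_int: "of_int k \<in> S"
proof -
  have "of_nat m \<in> S" for m
    by (induction m) (auto intro: is_subring_zero is_subring_one is_subring_add)
  then show ?thesis
    by (cases k) (auto intro!: is_subring_minus is_subring_diff is_subring_one)
qed

end

lemma is_subring_power_int:
  fixes S :: "'a::field set"
  assumes "is_subring S" "a \<in> S" "k < 0 \<Longrightarrow> 1 / a \<in> S"
  shows "a powi k \<in> S"
proof (cases "k \<ge> 0")
  case True
  then show ?thesis
    using assms by (simp add: power_int_nonneg_exp is_subring_power)
next
  case False
  then have "a powi k = (1 / a) ^ nat (- k)"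
    by (simp add: power_int_def inverse_eq_divide)
  with False assms show ?thesis
    by (simp add: is_subring_power)
qed

lemma is_subring_subring_generated: "is_subring (subring_generated A)"
  by (auto simp: is_subring_def intro: subring_generated.intros)

lemma subring_generated_subset:
  assumes "is_subring S" "A \<subseteq> S"
  shows "subring_generated A \<subseteq> S"
proof
  fix a assume "a \<in> subring_generated A"
  then show "a \<in> S"
    using assms by induction (auto intro: is_subring_one is_subring_diff is_subring_mult)
qed

definition is_ring_hom :: "('a::comm_ring_1 \<Rightarrow> 'b::comm_ring_1) \<Rightarrow> bool" where
  "is_ring_hom f \<longleftrightarrow> f 1 = 1 \<and> (\<forall>a b. f (a + b) = f a + f b \<and> f (a * b) = f a * f b)"

context
  fixes f :: "'a::comm_ring_1 \<Rightarrow> 'b::comm_ring_1"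
  assumes f: "is_ring_hom f"
begin

lemma is_ring_hom_one: "f 1 = 1"
  and is_ring_hom_add: "f (a + b) = f a + f b"
  and is_ring_hom_mult: "f (a * b) = f a * f b"
  using f by (auto simp: is_ring_hom_def)

lemma is_ring_hom_zero: "f 0 = 0"
  using is_ring_hom_add[of 0 0] by simp

lemma is_ring_hom_minus: "f (- a) = - f a"
  using is_ring_hom_add[of a "- a"] by (simp add: is_ring_hom_zero eq_neg_iff_add_eq_0 add.commute)

lemma is_ring_hom_diff: "f (a - b) = f a - f b"
  using is_ring_hom_add[of a "- b"] by (simp add: is_ring_hom_minus)

lemma is_ring_hom_sum: "f (sum g A) = (\<Sum>i\<in>A. f (g i))"
  by (induction A rule: infinite_finite_induct) (auto simp: is_ring_hom_zero is_ring_hom_add)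

lemma is_ring_hom_prod: "f (prod g A) = (\<Prod>i\<in>A. f (g i))"
  by (induction A rule: infinite_finite_induct) (auto simp: is_ring_hom_one is_ring_hom_mult)

lemma is_ring_hom_power: "f (a ^ k) = f a ^ k"
  by (induction k) (auto simp: is_ring_hom_one is_ring_hom_mult)

lemma is_ring_hom_of_int: "f (of_int k) = of_int k"
proof -
  have "f (of_nat m) = of_nat m" for m
    by (induction m) (auto simp: is_ring_hom_zero is_ring_hom_one is_ring_hom_add)
  then show ?thesis
    by (cases k) (auto simp: is_ring_hom_diff is_ring_hom_minus is_ring_hom_one)
qed

lemma is_subring_vimage: "is_subring S \<Longrightarrow> is_subring (f -` S)"
  by (auto simp: is_subring_def is_ring_hom_one is_ring_hom_diff is_ring_hom_mult)

lemma is_subring_image: "is_subring S \<Longrightarrow> is_subring (f ` S)"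
  unfolding is_subring_def
  by (auto simp: is_ring_hom_one is_ring_hom_diff[symmetric] is_ring_hom_mult[symmetric]
      intro: image_eqI[where x = 1])

end

lemmas is_ring_hom_simps =
  is_ring_hom_zero is_ring_hom_one is_ring_hom_add is_ring_hom_minus is_ring_hom_diff
  is_ring_hom_mult is_ring_hom_power is_ring_hom_sum is_ring_hom_prod is_ring_hom_of_int

lemma is_ring_hom_compose: "is_ring_hom f \<Longrightarrow> is_ring_hom g \<Longrightarrow> is_ring_hom (\<lambda>x. f (g x))"
  by (simp add: is_ring_hom_def)

lemma is_ring_hom_id: "is_ring_hom (\<lambda>x. x)"
  by (simp add: is_ring_hom_def)

lemma is_ring_hom_to_fract: "is_ring_hom to_fract"
  by (simp add: is_ring_hom_def)

context
  fixes f :: "'a::field \<Rightarrow> 'b::field"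
  assumes f: "is_ring_hom f"
begin

lemma is_ring_hom_eq_0_iff: "f a = 0 \<longleftrightarrow> a = 0"
proof
  assume "f a = 0"
  show "a = 0"
  proof (rule ccontr)
    assume "a \<noteq> 0"
    then have "f a * f (1 / a) = 1"
      using is_ring_hom_mult[OF f, of a "1 / a"] by (simp add: is_ring_hom_one[OF f])
    with \<open>f a = 0\<close> show False by simp
  qed
qed (simp add: is_ring_hom_zero[OF f])

lemma is_ring_hom_divide: "f (a / b) = f a / f b"
proof (cases "b = 0")
  case False
  then have "f (a / b) * f b = f a"
    by (simp add: is_ring_hom_mult[OF f, symmetric])
  with False show ?thesis
    by (simp add: field_simps is_ring_hom_eq_0_iff)
qed (simp add: is_ring_hom_zero[OF f])

lemma is_ring_hom_power_int: "f (a powi k) = f a powi k"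
  by (simp add: power_int_def is_ring_hom_power[OF f] inverse_eq_divide is_ring_hom_divide
      is_ring_hom_one[OF f])

end

section \<open>Evaluation of Laurent polynomials\<close>

text \<open>The values of the powers \<open>x\<^sub>i\<^sup>k\<close> are prescribed separately for every \<open>k\<close>, so that
  the target need not have inverses.\<close>

definition exponential :: "(nat \<Rightarrow> int \<Rightarrow> 'a::comm_ring_1) \<Rightarrow> bool" where
  "exponential g \<longleftrightarrow> (\<forall>i. g i 0 = 1 \<and> (\<forall>a b. g i (a + b) = g i a * g i b))"

definition eval_monom :: "(nat \<Rightarrow> int \<Rightarrow> 'a::comm_ring_1) \<Rightarrow> (nat \<Rightarrow>\<^sub>0 int) \<Rightarrow> 'a" where
  "eval_monom g m = (\<Prod>i\<in>keys m. g i (lookup m i))"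

definition eval_laurent :: "(nat \<Rightarrow> int \<Rightarrow> 'a::comm_ring_1) \<Rightarrow> laurent \<Rightarrow> 'a" where
  "eval_laurent g p = (\<Sum>m\<in>keys p. of_int (lookup p m) * eval_monom g m)"

lemma eval_laurent_in_subring:
  assumes "is_subring S" "\<And>m i. m \<in> keys p \<Longrightarrow> i \<in> keys m \<Longrightarrow> g i (lookup m i) \<in> S"
  shows "eval_laurent g p \<in> S"
  unfolding eval_laurent_def eval_monom_def
  by (intro is_subring_sum is_subring_mult is_subring_of_int is_subring_prod assms)

lemma eval_laurent_superset:
  assumes "finite A" "keys p \<subseteq> A"
  shows "eval_laurent g p = (\<Sum>m\<in>A. of_int (lookup p m) * eval_monom g m)"
  unfolding eval_laurent_def using assms
  by (intro sum.mono_neutral_left) (auto simp: in_keys_iff)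

lemma eval_laurent_add: "eval_laurent g (p + q) = eval_laurent g p + eval_laurent g q"
proof -
  let ?A = "keys p \<union> keys q"
  have "eval_laurent g (p + q) = (\<Sum>m\<in>?A. of_int (lookup (p + q) m) * eval_monom g m)"
    by (rule eval_laurent_superset) (auto dest: subsetD[OF Poly_Mapping.keys_add])
  also have "\<dots> = (\<Sum>m\<in>?A. of_int (lookup p m) * eval_monom g m) +
      (\<Sum>m\<in>?A. of_int (lookup q m) * eval_monom g m)"
    by (simp add: lookup_add ring_distribs sum.distrib)
  also have "\<dots> = eval_laurent g p + eval_laurent g q"
    by (simp add: eval_laurent_superset[of ?A])
  finally show ?thesis .
qed

lemma eval_laurent_single: "eval_laurent g (Poly_Mapping.single m c) = of_int c * eval_monom g m"
  by (simp add: eval_laurent_def)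

lemma laurent_eq_sum_singles:
  "p = (\<Sum>m\<in>keys p. Poly_Mapping.single m (lookup p m))" for p :: laurent
  by (rule poly_mapping_eqI)
    (auto simp: lookup_sum lookup_single when_def sum.delta in_keys_iff)

lemma laurent_induct [case_names single add]:
  assumes "\<And>m c. P (Poly_Mapping.single m c)" "\<And>p q. P p \<Longrightarrow> P q \<Longrightarrow> P (p + q)"
  shows "P (p :: laurent)"
proof -
  have "P (\<Sum>m\<in>A. Poly_Mapping.single m (lookup p m))" if "finite A" for A
    using that
  proof induction
    case empty
    then show ?case using assms(1)[of 0 0] by simp
  qed (auto intro: assms)
  from this[of "keys p"] show ?thesis
    by (simp flip: laurent_eq_sum_singles)
qed

context
  fixes g :: "nat \<Rightarrow> int \<Rightarrow> 'a::comm_ring_1"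
  assumes g: "exponential g"
begin

lemma eval_monom_superset:
  assumes "finite A" "keys m \<subseteq> A"
  shows "eval_monom g m = (\<Prod>i\<in>A. g i (lookup m i))"
  unfolding eval_monom_def using assms g
  by (intro prod.mono_neutral_left) (auto simp: in_keys_iff exponential_def)

lemma eval_monom_add: "eval_monom g (m + m') = eval_monom g m * eval_monom g m'"
proof -
  let ?A = "keys m \<union> keys m'"
  have "eval_monom g (m + m') = (\<Prod>i\<in>?A. g i (lookup (m + m') i))"
    by (rule eval_monom_superset) (auto dest: subsetD[OF Poly_Mapping.keys_add])
  also have "\<dots> = (\<Prod>i\<in>?A. g i (lookup m i)) * (\<Prod>i\<in>?A. g i (lookup m' i))"
    using g by (simp add: lookup_add exponential_def prod.distrib)
  also have "\<dots> = eval_monom g m * eval_monom g m'"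
    by (simp add: eval_monom_superset[of ?A])
  finally show ?thesis .
qed

lemma eval_laurent_mult: "eval_laurent g (p * q) = eval_laurent g p * eval_laurent g q"
proof (induction p rule: laurent_induct)
  case (single m c)
  show ?case
  proof (induction q rule: laurent_induct)
    case (single m' c')
    show ?case
      by (simp add: mult_single eval_laurent_single eval_monom_add ac_simps)
  qed (simp add: ring_distribs eval_laurent_add)
qed (simp add: ring_distribs eval_laurent_add)

lemma is_ring_hom_eval_laurent: "is_ring_hom (eval_laurent g)"
proof -
  have "eval_laurent g 1 = 1"
    using eval_laurent_single[of g 0 1] by (simp add: eval_monom_def)
  then show ?thesis
    by (simp add: is_ring_hom_def eval_laurent_add eval_laurent_mult)
qed

lemma eval_laurent_var_power: "eval_laurent g (var_power i k) = g i k"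
  using g by (simp add: var_power_def eval_laurent_single eval_monom_def exponential_def)

end

lemma var_power_0: "var_power i 0 = 1"
  by (simp add: var_power_def)

lemma var_power_add: "var_power i (a + b) = var_power i a * var_power i b"
  by (simp add: var_power_def mult_single single_add)

lemma eval_laurent_var_power_id: "eval_laurent var_power p = p"
proof -
  have mon: "eval_monom var_power m = Poly_Mapping.single m 1" for m
  proof -
    have "(\<Prod>i\<in>A. Poly_Mapping.single (Poly_Mapping.single i (lookup m i)) 1) =
        Poly_Mapping.single (\<Sum>i\<in>A. Poly_Mapping.single i (lookup m i)) (1::int)"
      if "finite A" for A
      using that by induction (auto simp: mult_single)
    moreover have "(\<Sum>i\<in>keys m. Poly_Mapping.single i (lookup m i)) = m"
      by (rule poly_mapping_eqI)
        (auto simp: lookup_sum lookup_single when_def sum.delta in_keys_iff)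
    ultimately show ?thesis
      by (simp add: eval_monom_def var_power_def)
  qed
  show ?thesis
  proof (induction p rule: laurent_induct)
    case (single m c)
    have "of_int c = Poly_Mapping.single (0 :: nat \<Rightarrow>\<^sub>0 int) c"
      by (metis single_of_int of_int_eq_id id_apply)
    then show ?case by (simp add: eval_laurent_single mon mult_single)
  qed (simp add: eval_laurent_add)
qed

text \<open>Every Laurent polynomial is an integer combination of products of the
  \<open>var_power i k\<close>, so a homomorphism is determined on these. Membership and equality
  questions about images thus reduce to powers of single variables.\<close>

lemma ring_hom_eq_eval_laurent:
  assumes "is_ring_hom f"
  shows "f p = eval_laurent (\<lambda>i k. f (var_power i k)) p"
proof -
  have "f p = f (eval_laurent var_power p)"
    by (simp add: eval_laurent_var_power_id)
  also have "\<dots> = eval_laurent (\<lambda>i k. f (var_power i k)) p"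
    unfolding eval_laurent_def eval_monom_def by (simp add: is_ring_hom_simps[OF assms])
  finally show ?thesis .
qed

lemma var_power_nonzero: "var_power i k \<noteq> 0"
  by (simp add: var_power_def)

text \<open>Each \<open>var_power i k\<close> is a unit with inverse
  \<open>var_power i (- k)\<close>. Hence \<open>f (var i)\<close> is nonzero and determines the
  negative powers too.\<close>

lemma ring_hom_var_power:
  fixes f :: "laurent \<Rightarrow> 'a::field"
  assumes f: "is_ring_hom f"
  shows "f (var_power i k) = f (var i) powi k"
proof -
  have inv: "f (var_power i k) * f (var_power i (- k)) = 1" for k
    using is_ring_hom_mult[OF f, of "var_power i k" "var_power i (- k)"]
    by (simp add: var_power_0 is_ring_hom_one[OF f] flip: var_power_add)
  have nat: "f (var_power i (int k)) = f (var i) ^ k" for k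
    by (induction k)
      (auto simp: var_power_0 var_power_add is_ring_hom_mult[OF f] is_ring_hom_one[OF f])
  show ?thesis
  proof (cases k)
    case (nonneg m)
    then show ?thesis by (simp add: nat)
  next
    case (neg m)
    then have "f (var_power i k) * f (var i) ^ Suc m = 1"
      using inv[of k] nat[of "Suc m"] neg by (metis minus_minus)
    then have "f (var_power i k) = inverse (f (var i) ^ Suc m)"
      by (metis inverse_unique mult.commute)
    with neg show ?thesis
      by (simp add: power_int_minus del: power_Suc of_nat_Suc)
  qed
qed

lemma ring_hom_eqI:
  fixes f h :: "laurent \<Rightarrow> 'a::field"
  assumes "is_ring_hom f" "is_ring_hom h" "\<And>i. f (var i) = h (var i)"
  shows "f p = h p"
proof -
  have "f (var_power i k) = h (var_power i k)" for i k
    using ring_hom_var_power[OF assms(1), of i k] ring_hom_var_power[OF assms(2), of i k] assms(3)[of i]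
    by metis
  then have "(\<lambda>i k. f (var_power i k)) = (\<lambda>i k. h (var_power i k))"
    by blast
  then have "eval_laurent (\<lambda>i k. f (var_power i k)) p = eval_laurent (\<lambda>i k. h (var_power i k)) p"
    by (rule arg_cong)
  from ring_hom_eq_eval_laurent[OF assms(1)] this ring_hom_eq_eval_laurent[OF assms(2), symmetric]
  show ?thesis
    by (rule trans[OF trans])
qed

section \<open>Sum of coefficients and specialisation as evaluations\<close>

definition sum_coeffs :: "laurent \<Rightarrow> int" where
  "sum_coeffs = eval_laurent (\<lambda>i k. 1)"

lemma exponential_one: "exponential (\<lambda>i k. 1)"
  by (simp add: exponential_def)

lemma is_ring_hom_sum_coeffs: "is_ring_hom sum_coeffs"
  unfolding sum_coeffs_def by (rule is_ring_hom_eval_laurent[OF exponential_one])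

lemma sum_coeffs_var_power: "sum_coeffs (var_power i k) = 1"
  unfolding sum_coeffs_def by (rule eval_laurent_var_power[OF exponential_one])

lemma specialise_eq_eval_laurent: "specialise \<sigma> = eval_laurent (specialise_power \<sigma>)"
  by (rule ext) (simp only: specialise_def eval_laurent_def eval_monom_def)

text \<open>The power depends only on the parity of the exponent, and parity is additive. This makes
  the convention with absolute values in \<open>specialise_power\<close> multiplicative.\<close>

lemma unit_power_nat_abs_add:
  fixes c :: int
  assumes "c = 1 \<or> c = - 1"
  shows "c ^ nat \<bar>a + b\<bar> = c ^ nat \<bar>a\<bar> * c ^ nat \<bar>b\<bar>"
proof -
  have "c ^ nat \<bar>k\<bar> = (if even k then 1 else c)" for k :: int
    using assms by (auto simp: even_nat_iff)
  with assms show ?thesis by auto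
qed

lemma exponential_specialise_power:
  assumes "is_specialisation n \<sigma>"
  shows "exponential (specialise_power \<sigma>)"
  unfolding exponential_def
proof (intro allI conjI)
  fix i a b
  have "\<sigma> i = Some c \<Longrightarrow> c = 1 \<or> c = - 1" for c
    using assms by (auto simp: is_specialisation_def ran_def)
  then show "specialise_power \<sigma> i (a + b) = specialise_power \<sigma> i a * specialise_power \<sigma> i b"
    by (auto simp: specialise_power_def var_power_add unit_power_nat_abs_add
        split: option.split simp flip: of_int_power of_int_mult)
qed (auto simp: specialise_power_def var_power_0 split: option.split)

lemma is_ring_hom_specialise: "is_specialisation n \<sigma> \<Longrightarrow> is_ring_hom (specialise \<sigma>)"
  by (simp add: specialise_eq_eval_laurent is_ring_hom_eval_laurent exponential_specialise_power)

lemma specialise_var_power: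
  "is_specialisation n \<sigma> \<Longrightarrow> specialise \<sigma> (var_power i k) = specialise_power \<sigma> i k"
  by (simp add: specialise_eq_eval_laurent eval_laurent_var_power exponential_specialise_power)

section \<open>Splitting Laurent polynomials by exponents\<close>

lemma is_subring_keys_subset:
  assumes "0 \<in> M" "\<And>m m'. m \<in> M \<Longrightarrow> m' \<in> M \<Longrightarrow> m + m' \<in> M"
  shows "is_subring {p :: laurent. keys p \<subseteq> M}"
proof -
  have "keys (a * b) \<subseteq> M" if "keys a \<subseteq> M" "keys b \<subseteq> M" for a b :: laurent
    using keys_mult[of a b] that assms(2) by blast
  moreover have "keys (a - b) \<subseteq> M" if "keys a \<subseteq> M" "keys b \<subseteq> M" for a b :: laurent
    using keys_diff[of a b] that by blast
  ultimately show ?thesis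
    using assms(1) by (auto simp: is_subring_def)
qed

lemma ex_keys_split:
  "\<exists>p1 p2. p = p1 + p2 \<and> keys p1 \<subseteq> M \<and> keys p2 \<subseteq> - M" for p :: laurent
proof (induction p rule: laurent_induct)
  case (single m c)
  show ?case
  proof (cases "m \<in> M")
    case True
    then show ?thesis
      by (intro exI[of _ "Poly_Mapping.single m c"] exI[of _ 0]) auto
  next
    case False
    then show ?thesis
      by (intro exI[of _ 0] exI[of _ "Poly_Mapping.single m c"]) auto
  qed
next
  case (add p q)
  then obtain p1 p2 q1 q2 where "p = p1 + p2" "keys p1 \<subseteq> M" "keys p2 \<subseteq> - M"
    "q = q1 + q2" "keys q1 \<subseteq> M" "keys q2 \<subseteq> - M" by blast
  then have "p + q = (p1 + q1) + (p2 + q2)" "keys (p1 + q1) \<subseteq> M" "keys (p2 + q2) \<subseteq> - M"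
    using Poly_Mapping.keys_add[of p1 q1] Poly_Mapping.keys_add[of p2 q2] by auto
  then show ?case by blast
qed

lemma keys_disjoint_imp_zero: "keys p \<subseteq> M \<Longrightarrow> keys p \<subseteq> - M \<Longrightarrow> p = 0"
  by (metis Int_absorb Int_greatest compl_inf_bot inf.absorb_iff2 keys_eq_empty le_bot order_trans subset_Compl_self_eq)

lemma laurent_subring_induct:
  assumes "is_subring S" "\<And>i k. var_power i k \<in> S"
  shows "p \<in> S"
  using eval_laurent_in_subring[of S p var_power] assms by (simp add: eval_laurent_var_power_id)

definition free_of :: "nat \<Rightarrow> laurent set" where
  "free_of j = {p. keys p \<subseteq> {m. lookup m j = 0}}"

definition poly_in :: "nat \<Rightarrow> laurent set" where
  "poly_in j = {p. keys p \<subseteq> {m. 0 \<le> lookup m j}}"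

lemma is_subring_free_of: "is_subring (free_of j)"
  unfolding free_of_def by (rule is_subring_keys_subset) (auto simp: lookup_add)

lemma is_subring_poly_in: "is_subring (poly_in j)"
  unfolding poly_in_def by (rule is_subring_keys_subset) (auto simp: lookup_add)

lemma free_of_subset_poly_in: "free_of j \<subseteq> poly_in j"
  by (auto simp: free_of_def poly_in_def)

lemma var_power_in_free_of: "i \<noteq> j \<Longrightarrow> var_power i k \<in> free_of j"
  by (auto simp: var_power_def free_of_def lookup_single)

lemma var_power_in_poly_in: "i \<noteq> j \<or> 0 \<le> k \<Longrightarrow> var_power i k \<in> poly_in j"
  by (auto simp: var_power_def poly_in_def lookup_single when_def)

text \<open>Multiplication by \<open>p\<close> preserves exponents of \<open>x_j\<close>. If
  \<open>g2\<close> is the part of \<open>g\<close> with negative exponents, then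
  \<open>p * g2\<close> has only negative exponents but also lies in \<open>poly_in j\<close>, so it
  vanishes; the Laurent ring being a domain, \<open>g2\<close> vanishes.\<close>

lemma poly_in_cancel:
  assumes p: "p \<in> free_of j" "p \<noteq> 0" and pg: "p * g \<in> poly_in j"
  shows "g \<in> poly_in j"
proof -
  let ?M = "{m :: nat \<Rightarrow>\<^sub>0 int. 0 \<le> lookup m j}"
  obtain g1 g2 where g: "g = g1 + g2" "keys g1 \<subseteq> ?M" "keys g2 \<subseteq> - ?M"
    using ex_keys_split by blast
  have "p * g2 = p * g - p * g1"
    by (simp add: g(1) algebra_simps)
  moreover have "p * g1 \<in> poly_in j"
    using p(1) free_of_subset_poly_in g(2)
    by (intro is_subring_mult[OF is_subring_poly_in]) (auto simp: poly_in_def)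
  ultimately have "keys (p * g2) \<subseteq> ?M"
    using pg is_subring_diff[OF is_subring_poly_in] by (auto simp: poly_in_def)
  moreover have "keys (p * g2) \<subseteq> - ?M"
    using keys_mult[of p g2] p(1) g(3) by (fastforce simp: free_of_def lookup_add)
  ultimately have "p * g2 = 0"
    by (rule keys_disjoint_imp_zero)
  then have "g2 = 0"
    using p(2) by simp
  then show ?thesis
    using g by (simp add: poly_in_def)
qed

section \<open>Exchange automorphisms of the field of rational functions\<close>

abbreviation X :: "nat \<Rightarrow> ratfun" where
  "X i \<equiv> to_fract (var i)"

definition laurents :: "ratfun set" where
  "laurents = range to_fract"

lemma is_subring_laurents: "is_subring laurents"
  unfolding laurents_def
  by (rule is_subring_image[OF is_ring_hom_to_fract]) (simp add: is_subring_def)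

lemma X_nonzero: "X i \<noteq> 0"
  by (simp add: var_power_nonzero)

lemma X_powi: "X i powi k = to_fract (var_power i k)"
  using ring_hom_var_power[OF is_ring_hom_to_fract, of i k] by (rule sym)

lemma inverse_X: "1 / X i = to_fract (var_power i (- 1))"
  using X_powi[of i "-1"] by (simp add: power_int_minus inverse_eq_divide)

lemma X_in_laurents: "X i \<in> laurents" "1 / X i \<in> laurents"
  by (simp_all add: laurents_def inverse_X)

lemma ratfun_cases:
  fixes z :: ratfun
  obtains a b where "b \<noteq> 0" "z = to_fract a / to_fract b"
  by (cases z) (simp add: Fract_conv_to_fract)

lemma ratfun_hom_eqI:
  fixes f h :: "ratfun \<Rightarrow> 'a::field"
  assumes f: "is_ring_hom f" and h: "is_ring_hom h" and eq: "\<And>i. f (X i) = h (X i)"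
  shows "f z = h z"
proof -
  have "f (to_fract a) = h (to_fract a)" for a
    using ring_hom_eqI[OF is_ring_hom_compose[OF f is_ring_hom_to_fract]
        is_ring_hom_compose[OF h is_ring_hom_to_fract]] eq by blast
  moreover obtain a b where "z = to_fract a / to_fract b"
    by (rule ratfun_cases)
  ultimately show ?thesis
    by (simp add: is_ring_hom_divide[OF f] is_ring_hom_divide[OF h])
qed

lemma ratfun_hom_in_subring:
  fixes f :: "ratfun \<Rightarrow> 'a::field"
  assumes f: "is_ring_hom f" and S: "is_subring S"
    and "\<And>m i. m \<in> keys p \<Longrightarrow> i \<in> keys m \<Longrightarrow> f (X i) powi lookup m i \<in> S"
  shows "f (to_fract p) \<in> S"
proof -
  have "f (to_fract p) = eval_laurent (\<lambda>i k. f (to_fract (var_power i k))) p"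
    by (rule ring_hom_eq_eval_laurent[OF is_ring_hom_compose[OF f is_ring_hom_to_fract]])
  also have "\<dots> \<in> S"
    using assms(3)
    by (intro eval_laurent_in_subring[OF S]) (simp add: is_ring_hom_power_int[OF f, symmetric] X_powi)
  finally show ?thesis .
qed

text \<open>Elements of \<open>poly_in j\<close> involve no negative power of \<open>x_j\<close>, so
  the inverse of \<open>f (X j)\<close> may lie outside \<open>S\<close>. This is what bounds the
  denominators in the Laurent arguments below.\<close>

lemma ratfun_hom_poly_in:
  fixes f :: "ratfun \<Rightarrow> 'a::field"
  assumes f: "is_ring_hom f" and S: "is_subring S" and p: "p \<in> poly_in j"
    and "\<And>i. f (X i) \<in> S" "\<And>i. i \<noteq> j \<Longrightarrow> 1 / f (X i) \<in> S"
  shows "f (to_fract p) \<in> S"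
proof (rule ratfun_hom_in_subring[OF f S])
  fix m i assume "m \<in> keys p" "i \<in> keys m"
  then have "lookup m i < 0 \<Longrightarrow> i \<noteq> j"
    using p by (auto simp: poly_in_def)
  then show "f (X i) powi lookup m i \<in> S"
    using assms(4,5) by (intro is_subring_power_int[OF S]) simp_all
qed

lemma ratfun_hom_laurents:
  fixes f :: "ratfun \<Rightarrow> 'a::field"
  assumes f: "is_ring_hom f" and S: "is_subring S" and z: "z \<in> laurents"
    and "\<And>i. f (X i) \<in> S" "\<And>i. 1 / f (X i) \<in> S"
  shows "f z \<in> S"
proof -
  obtain p where p: "z = to_fract p"
    using z by (auto simp: laurents_def)
  have "f (X i) powi k \<in> S" for i k
    using assms(4,5) by (intro is_subring_power_int[OF S]) simp_all
  then show ?thesis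
    unfolding p by (intro ratfun_hom_in_subring[OF f S])
qed

text \<open>The extension of an injective homomorphism to the fraction field; the choice is independent
  of the representation only for injective ones.\<close>

definition fract_hom :: "(laurent \<Rightarrow> 'a::field) \<Rightarrow> ratfun \<Rightarrow> 'a" where
  "fract_hom f z = (SOME w. \<exists>a b. b \<noteq> 0 \<and> z = to_fract a / to_fract b \<and> w = f a / f b)"

context
  fixes f :: "laurent \<Rightarrow> 'a::field"
  assumes f: "is_ring_hom f" and inj: "\<And>a. f a = 0 \<Longrightarrow> a = 0"
begin

lemma fract_hom_divide:
  assumes "b \<noteq> 0"
  shows "fract_hom f (to_fract a / to_fract b) = f a / f b"
  unfolding fract_hom_def
proof (rule some_equality)
  show "\<exists>a' b'. b' \<noteq> 0 \<and> to_fract a / to_fract b = to_fract a' / to_fract b' \<and>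
      f a / f b = f a' / f b'"
    using assms by blast
  fix w
  assume "\<exists>a' b'. b' \<noteq> 0 \<and> to_fract a / to_fract b = to_fract a' / to_fract b' \<and> w = f a' / f b'"
  then obtain a' b' where that:
    "b' \<noteq> 0" "to_fract a / to_fract b = to_fract a' / to_fract b'" "w = f a' / f b'"
    by blast
  then have "to_fract (a * b') = to_fract (a' * b)"
    using assms by (simp add: field_simps)
  then have "f (a * b') = f (a' * b)"
    unfolding to_fract_eq_iff by simp
  moreover have "f b \<noteq> 0" "f b' \<noteq> 0"
    using inj assms that(1) by auto
  ultimately show "w = f a / f b"
    unfolding that(3) by (simp add: is_ring_hom_mult[OF f] field_simps)
qed

lemma fract_hom_to_fract: "fract_hom f (to_fract a) = f a"
  using fract_hom_divide[of 1 a] by (simp add: is_ring_hom_one[OF f])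

lemma is_ring_hom_fract_hom: "is_ring_hom (fract_hom f)"
proof -
  have nz: "f a \<noteq> 0" if "a \<noteq> 0" for a
    using inj that by blast
  have "fract_hom f (z + w) = fract_hom f z + fract_hom f w \<and>
      fract_hom f (z * w) = fract_hom f z * fract_hom f w" for z w
  proof -
    obtain a b where ab: "b \<noteq> 0" "z = to_fract a / to_fract b" by (rule ratfun_cases)
    obtain c d where cd: "d \<noteq> 0" "w = to_fract c / to_fract d" by (rule ratfun_cases)
    have "z + w = to_fract (a * d + c * b) / to_fract (b * d)"
      "z * w = to_fract (a * c) / to_fract (b * d)"
      unfolding ab(2) cd(2) using ab(1) cd(1) by (simp_all add: field_simps)
    then have "fract_hom f (z + w) = f (a * d + c * b) / f (b * d)"
      "fract_hom f (z * w) = f (a * c) / f (b * d)"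
      using ab cd by (simp_all only: fract_hom_divide mult_eq_0_iff simp_thms)
    moreover have "fract_hom f z = f a / f b" "fract_hom f w = f c / f d"
      unfolding ab(2) cd(2) by (rule fract_hom_divide[OF ab(1)], rule fract_hom_divide[OF cd(1)])
    ultimately show ?thesis
      using nz[OF ab(1)] nz[OF cd(1)] by (simp add: is_ring_hom_mult[OF f] is_ring_hom_add[OF f] add_frac_eq)
  qed
  then show ?thesis
    using fract_hom_to_fract[of 1] by (simp add: is_ring_hom_def is_ring_hom_one[OF f])
qed

end

text \<open>Formed inside the ambient ring rather than as a ring of fractions, so that localisations
  at different elements can be intersected.\<close>

definition localisation :: "'a::comm_ring_1 \<Rightarrow> 'a set \<Rightarrow> 'a set" where
  "localisation a S = {z. \<exists>k. a ^ k * z \<in> S}"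

lemma localisation_superset: "S \<subseteq> localisation a S"
  by (auto simp: localisation_def intro: exI[of _ 0])

lemma is_subring_localisation:
  assumes S: "is_subring S" and a: "a \<in> S"
  shows "is_subring (localisation a S)"
  unfolding is_subring_def
proof (intro conjI ballI)
  show "1 \<in> localisation a S"
    using localisation_superset is_subring_one[OF S] by blast
  fix z w assume "z \<in> localisation a S" "w \<in> localisation a S"
  then obtain k l where kl: "a ^ k * z \<in> S" "a ^ l * w \<in> S"
    by (auto simp: localisation_def)
  have "a ^ (k + l) * (z - w) = a ^ l * (a ^ k * z) - a ^ k * (a ^ l * w)"
    by (simp add: algebra_simps power_add)
  also have "\<dots> \<in> S"
    by (rule is_subring_diff[OF S]; rule is_subring_mult[OF S]) (simp_all add: is_subring_power[OF S] kl a)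
  finally show "z - w \<in> localisation a S"
    by (auto simp: localisation_def)
  have "a ^ (k + l) * (z * w) = (a ^ k * z) * (a ^ l * w)"
    by (simp add: algebra_simps power_add)
  also have "\<dots> \<in> S"
    using kl by (rule is_subring_mult[OF S])
  finally show "z * w \<in> localisation a S"
    by (auto simp: localisation_def)
qed

lemma localisationI: "a ^ k * z \<in> S \<Longrightarrow> z \<in> localisation a S"
  by (auto simp: localisation_def)

lemma inverse_in_localisation:
  fixes a :: "'a::field"
  assumes "is_subring S" "a \<noteq> 0"
  shows "1 / a \<in> localisation a S"
  using assms is_subring_one by (intro localisationI[where k = 1]) auto

definition flip_vars :: "nat \<Rightarrow> laurent \<Rightarrow> nat \<Rightarrow> ratfun" where
  "flip_vars j p = (\<lambda>i. X i)(j := to_fract p / X j)"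

text \<open>For the exchange polynomial \<open>p\<close> at \<open>j\<close> this substitutes the
  neighbouring cluster for the initial one. It is an involution, so \<open>z\<close> is Laurent in
  the neighbouring cluster exactly when \<open>flip j p z\<close> lies in
  \<open>laurents\<close>.\<close>

definition flip :: "nat \<Rightarrow> laurent \<Rightarrow> ratfun \<Rightarrow> ratfun" where
  "flip j p = fract_hom (eval_laurent (\<lambda>i k. flip_vars j p i powi k))"

locale exchange_pair =
  fixes j :: nat and p :: laurent
  assumes nonzero: "p \<noteq> 0" and free: "p \<in> free_of j"
begin

abbreviation "ev \<equiv> eval_laurent (\<lambda>i k. flip_vars j p i powi k)"

lemma flip_vars_nonzero: "flip_vars j p i \<noteq> 0"
  using nonzero by (simp add: flip_vars_def var_power_nonzero)

lemma exponential_flip_vars: "exponential (\<lambda>i k. flip_vars j p i powi k)"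
  by (simp add: exponential_def power_int_add flip_vars_nonzero)

lemma is_ring_hom_ev: "is_ring_hom ev"
  by (rule is_ring_hom_eval_laurent[OF exponential_flip_vars])

lemma ev_var_power: "ev (var_power i k) = flip_vars j p i powi k"
  by (rule eval_laurent_var_power[OF exponential_flip_vars])

lemma ev_free_of:
  assumes "q \<in> free_of j"
  shows "ev q = to_fract q"
proof -
  have "to_fract q = eval_laurent (\<lambda>i k. X i powi k) q"
    using ring_hom_eq_eval_laurent[OF is_ring_hom_to_fract, of q] by (simp only: X_powi)
  also have "\<dots> = ev q"
    using assms unfolding eval_laurent_def eval_monom_def
    by (intro sum.cong prod.cong arg_cong2[where f = "(*)"] refl)
      (fastforce simp: free_of_def flip_vars_def in_keys_iff)
  finally show ?thesis by (rule sym)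
qed

text \<open>This expresses that the substitution is an involution before it is extended to the
  fraction field: applying \<open>ev\<close> to the numerator \<open>q\<close> of
  \<open>ev r\<close> gives back \<open>r\<close> up to a power of \<open>p\<close>. The injectivity
  required by \<open>fract_hom\<close> follows.\<close>

lemma ev_clear_denominators:
  "\<exists>k q. to_fract p ^ k * ev r = to_fract q \<and> ev q = to_fract p ^ k * to_fract r"
proof -
  let ?Q = "\<lambda>r k q. to_fract p ^ k * ev r = to_fract q \<and> ev q = to_fract p ^ k * to_fract r"
  let ?S = "{r. \<exists>k q. ?Q r k q}"
  have "is_subring ?S"
    unfolding is_subring_def
  proof (intro conjI ballI)
    have "?Q 1 0 1"
      by (simp add: is_ring_hom_one[OF is_ring_hom_ev])
    then show "1 \<in> ?S" by blast
    fix r s assume "r \<in> ?S" "s \<in> ?S"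
    then obtain k q l t where 1: "?Q r k q" and 2: "?Q s l t"
      by auto
    have "?Q (r - s) (k + l) (p ^ l * q - p ^ k * t)"
      using 1 2 by (simp add: is_ring_hom_simps[OF is_ring_hom_ev] is_ring_hom_simps[OF is_ring_hom_to_fract]
          ev_free_of[OF free] algebra_simps power_add)
    then show "r - s \<in> ?S" by blast
    have "?Q (r * s) (k + l) (q * t)"
      using 1 2 by (simp add: is_ring_hom_simps[OF is_ring_hom_ev] is_ring_hom_simps[OF is_ring_hom_to_fract]
          algebra_simps power_add)
    then show "r * s \<in> ?S" by blast
  qed
  moreover have "var_power i k \<in> ?S" for i k
  proof -
    have *: "ev (var_power i k) = flip_vars j p i powi k" for k by (rule ev_var_power)
    consider "i \<noteq> j" | "i = j" "k \<ge> 0" | "i = j" "k < 0" by linarith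
    then show ?thesis
    proof cases
      case 1
      then have "?Q (var_power i k) 0 (var_power i k)"
        unfolding * by (simp add: flip_vars_def X_powi)
      then show ?thesis by blast
    next
      case 2
      then have "?Q (var_power i k) 0 (p ^ nat k * var_power i (- k))"
        unfolding * is_ring_hom_mult[OF is_ring_hom_ev] is_ring_hom_power[OF is_ring_hom_ev]
          ev_free_of[OF free] to_fract_mult is_ring_hom_power[OF is_ring_hom_to_fract]
        by (simp add: X_powi[of j "- k", symmetric] X_powi[of j k, symmetric] flip_vars_def power_int_divide_distrib power_int_minus power_int_nonneg_exp
            nonzero field_simps)
      then show ?thesis by blast
    next
      case 3
      then have "?Q (var_power i k) (nat (- k)) (var_power i (- k))"
        unfolding * X_powi[of i k, symmetric] X_powi[of i "- k", symmetric]
        by (simp add: flip_vars_def power_int_divide_distrib power_int_def nonzero field_simps)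
      then show ?thesis by blast
    qed
  qed
  ultimately have "r \<in> ?S"
    by (rule laurent_subring_induct)
  then show ?thesis by simp
qed

lemma ev_eq_0: "ev r = 0 \<Longrightarrow> r = 0"
proof -
  assume r: "ev r = 0"
  obtain k q where "to_fract p ^ k * ev r = to_fract q" "ev q = to_fract p ^ k * to_fract r"
    using ev_clear_denominators by blast
  with r show "r = 0"
    using nonzero by (simp add: is_ring_hom_zero[OF is_ring_hom_ev])
qed

lemma is_ring_hom_flip: "is_ring_hom (flip j p)"
  unfolding flip_def by (rule is_ring_hom_fract_hom[OF is_ring_hom_ev ev_eq_0])

lemma flip_to_fract: "flip j p (to_fract q) = ev q"
  unfolding flip_def by (rule fract_hom_to_fract[OF is_ring_hom_ev ev_eq_0])

lemma flip_free_of: "q \<in> free_of j \<Longrightarrow> flip j p (to_fract q) = to_fract q"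
  by (simp add: flip_to_fract ev_free_of)

lemma flip_X: "flip j p (X i) = (if i = j then to_fract p / X j else X i)"
  using ev_var_power[of i 1] by (simp add: flip_to_fract flip_vars_def)

lemma flip_flip: "flip j p (flip j p z) = z"
proof (rule ratfun_hom_eqI[OF is_ring_hom_compose[OF is_ring_hom_flip is_ring_hom_flip] is_ring_hom_id])
  fix i
  show "flip j p (flip j p (X i)) = X i"
    using nonzero by (auto simp: flip_X is_ring_hom_divide[OF is_ring_hom_flip] flip_free_of[OF free] var_power_nonzero)
qed

text \<open>Among the images of the variables and their inverses, only \<open>X j / p\<close>, the
  image of \<open>1 / X j\<close>, can fail to be Laurent, and its denominator is
  \<open>p\<close>.\<close>

lemma flip_laurents_localisation:
  assumes "z \<in> laurents"
  shows "flip j p z \<in> localisation (to_fract p) laurents"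
proof (rule ratfun_hom_laurents[OF is_ring_hom_flip _ assms])
  have p: "to_fract p \<in> laurents" by (simp add: laurents_def)
  note inv = X_in_laurents(2)
  have loc: "z \<in> localisation (to_fract p) laurents" if "z \<in> laurents" for z
    using that localisation_superset by blast
  show "is_subring (localisation (to_fract p) laurents)"
    by (rule is_subring_localisation[OF is_subring_laurents p])
  fix i
  show "flip j p (X i) \<in> localisation (to_fract p) laurents"
    using is_subring_mult[OF is_subring_laurents p inv[of j]]
    by (auto simp: flip_X intro!: loc) (simp add: laurents_def)
  show "1 / flip j p (X i) \<in> localisation (to_fract p) laurents"
  proof (cases "i = j")
    case True
    then show ?thesis
      using nonzero by (intro localisationI[where k = 1]) (simp add: flip_X laurents_def)
  next
    case False
    then show ?thesis by (simp add: flip_X loc inv)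
  qed
qed

text \<open>Split \<open>z\<close> by the sign of the exponent of \<open>x_j\<close>. The
  nonnegative part \<open>e1\<close> flips to a Laurent polynomial, hence so does the negative part
  \<open>r\<close>. The flip turns \<open>1 / x_j\<close> into \<open>x_j / p\<close>, so the image
  \<open>e2\<close> of \<open>r\<close> has no negative powers of \<open>x_j\<close> once multiplied
  by a power of \<open>p\<close>, and \<open>poly_in_cancel\<close> removes that power.\<close>

lemma laurent_both_decompose:
  assumes z: "z \<in> laurents" "flip j p z \<in> laurents"
  obtains e1 e2 where "e1 \<in> poly_in j" "e2 \<in> poly_in j" "z = to_fract e1 + flip j p (to_fract e2)"
proof -
  let ?M = "{m :: nat \<Rightarrow>\<^sub>0 int. 0 \<le> lookup m j}"
  obtain q where q: "z = to_fract q"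
    using z(1) by (auto simp: laurents_def)
  obtain e1 r where er: "q = e1 + r" "keys e1 \<subseteq> ?M" "keys r \<subseteq> - ?M"
    using ex_keys_split by blast
  have e1: "e1 \<in> poly_in j"
    using er(2) by (simp add: poly_in_def)
  have "flip j p (to_fract e1) \<in> laurents"
  proof (rule ratfun_hom_poly_in[OF is_ring_hom_flip is_subring_laurents e1])
    fix i
    have "to_fract p * (1 / X j) \<in> laurents"
      by (intro is_subring_mult[OF is_subring_laurents] X_in_laurents) (simp add: laurents_def)
    then show "flip j p (X i) \<in> laurents"
      by (auto simp: flip_X laurents_def)
    show "i \<noteq> j \<Longrightarrow> 1 / flip j p (X i) \<in> laurents"
      by (simp add: flip_X X_in_laurents)
  qed
  then have "flip j p z - flip j p (to_fract e1) \<in> laurents"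
    using z(2) by (intro is_subring_diff[OF is_subring_laurents])
  then have "flip j p (to_fract r) \<in> laurents"
    by (simp add: q er(1) is_ring_hom_add[OF is_ring_hom_flip])
  then obtain e2 where e2: "flip j p (to_fract r) = to_fract e2"
    by (auto simp: laurents_def)
  let ?T = "to_fract ` poly_in j"
  have T: "is_subring ?T"
    by (rule is_subring_image[OF is_ring_hom_to_fract is_subring_poly_in])
  have pT: "to_fract p \<in> ?T"
    using free free_of_subset_poly_in by blast
  have "flip j p (to_fract r) \<in> localisation (to_fract p) ?T"
  proof (rule ratfun_hom_in_subring[OF is_ring_hom_flip is_subring_localisation[OF T pT]])
    fix m i assume m: "m \<in> keys r" "i \<in> keys m"
    show "flip j p (X i) powi lookup m i \<in> localisation (to_fract p) ?T"
    proof (cases "i = j")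
      case False
      then have "flip j p (X i) powi lookup m i = to_fract (var_power i (lookup m i))"
        by (simp add: flip_X X_powi)
      with False show ?thesis
        by (auto intro!: subsetD[OF localisation_superset] var_power_in_poly_in)
    next
      case True
      let ?k = "- lookup m j"
      have k: "?k > 0"
        using er(3) m True by auto
      then have "to_fract p ^ nat ?k * flip j p (X i) powi lookup m i = X j powi ?k"
        using True nonzero by (simp add: flip_X power_int_divide_distrib power_int_def field_simps)
      also have "\<dots> \<in> ?T"
        using k by (auto simp: X_powi intro!: var_power_in_poly_in)
      finally show ?thesis
        by (rule localisationI)
    qed
  qed
  then obtain k s where "to_fract p ^ k * to_fract e2 = to_fract s" "s \<in> poly_in j"
    by (auto simp: localisation_def e2)
  moreover have "to_fract p ^ k * to_fract e2 = to_fract (p ^ k * e2)"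
    by (simp add: is_ring_hom_power[OF is_ring_hom_to_fract])
  ultimately have "p ^ k * e2 \<in> poly_in j"
    by (metis to_fract_eq_iff)
  then have "e2 \<in> poly_in j"
    using nonzero is_subring_power[OF is_subring_free_of free] poly_in_cancel[of "p ^ k" j e2] by simp
  moreover have "z = to_fract e1 + flip j p (to_fract e2)"
    by (simp add: q er(1) flip_flip flip: e2)
  ultimately show thesis
    using that e1 by blast
qed

end

section \<open>Coprimality by gradings\<close>

definition weight :: "nat \<Rightarrow> (nat \<Rightarrow> int) \<Rightarrow> (nat \<Rightarrow>\<^sub>0 int) \<Rightarrow> int" where
  "weight N l m = (\<Sum>i\<in>{1..N}. l i * lookup m i)"

definition homogeneous :: "nat \<Rightarrow> (nat \<Rightarrow> int) \<Rightarrow> int \<Rightarrow> laurent \<Rightarrow> bool" where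
  "homogeneous N l d p \<longleftrightarrow> (\<forall>m\<in>keys p. weight N l m = d)"

lemma weight_add: "weight N l (m + m') = weight N l m + weight N l m'"
  by (simp add: weight_def lookup_add ring_distribs sum.distrib)

lemma weight_zero: "weight N l 0 = 0"
  by (simp add: weight_def)

lemma homogeneous_add: "homogeneous N l d p \<Longrightarrow> homogeneous N l d q \<Longrightarrow> homogeneous N l d (p + q)"
  using Poly_Mapping.keys_add[of p q] by (auto simp: homogeneous_def)

lemma homogeneous_minus: "homogeneous N l d p \<Longrightarrow> homogeneous N l d (- p)"
  by (simp add: homogeneous_def)

lemma homogeneous_mult:
  "homogeneous N l d p \<Longrightarrow> homogeneous N l e q \<Longrightarrow> homogeneous N l (d + e) (p * q)"
  using keys_mult[of p q] by (auto simp: homogeneous_def weight_add)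

lemma homogeneous_one: "homogeneous N l 0 1"
  by (simp add: homogeneous_def weight_zero)

lemma homogeneous_power: "homogeneous N l d p \<Longrightarrow> homogeneous N l (int k * d) (p ^ k)"
  by (induction k) (auto simp: homogeneous_one ring_distribs intro: homogeneous_mult)

lemma homogeneous_single: "homogeneous N l (weight N l m) (Poly_Mapping.single m 1)"
  by (simp add: homogeneous_def)

text \<open>Coprimality in the form of Euclid's lemma: a homogeneous \<open>p\<close> is coprime to
  a binomial whose terms have different weights.\<close>

lemma homogeneous_dvd_binomial_mult:
  fixes p :: laurent
  assumes p: "homogeneous N l d p"
    and dvd: "p dvd a * (Poly_Mapping.single m1 1 + Poly_Mapping.single m2 1)"
    and ne: "weight N l m1 \<noteq> weight N l m2"
  shows "p dvd a"
proof -
  let ?w = "weight N l"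
  let ?M1 = "Poly_Mapping.single m1 1 :: laurent" and ?M2 = "Poly_Mapping.single m2 1 :: laurent"
  obtain B where B: "\<And>x. x \<in> keys a \<Longrightarrow> \<bar>?w x\<bar> \<le> B"
    using finite_keys[of a] by (meson finite_imageI Max_ge image_eqI)
  \<comment> \<open>Modulo \<open>p\<close>, the product \<open>a * ?M1 ^ r\<close> equals \<open>a * (- ?M2) ^ r\<close>, but for large \<open>r\<close> the
    two have no weight in common, so \<open>p\<close> divides both.\<close>
  define r where "r = nat (2 * \<bar>B\<bar> + 1)"
  \<comment> \<open>Two weights on \<open>keys a\<close> differ by at most
    \<open>2 * \<bar>B\<bar>\<close>, which is less than \<open>r\<close>, while the two shifts
    differ by at least \<open>r\<close>.\<close>
  have far: "?w x + int r * ?w m1 \<noteq> ?w y + int r * ?w m2" if "x \<in> keys a" "y \<in> keys a" for x y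
  proof
    assume "?w x + int r * ?w m1 = ?w y + int r * ?w m2"
    then have "\<bar>int r * (?w m1 - ?w m2)\<bar> = \<bar>?w y - ?w x\<bar>"
      by (simp add: algebra_simps)
    moreover have "\<bar>int r * (?w m1 - ?w m2)\<bar> \<ge> int r * 1"
      unfolding abs_mult using ne by (intro mult_mono) auto
    moreover have "\<bar>?w y - ?w x\<bar> \<le> 2 * \<bar>B\<bar>"
      using B[OF that(1)] B[OF that(2)] by linarith
    ultimately show False
      by (simp add: r_def)
  qed
  have "?M1 - (- ?M2) dvd ?M1 ^ r - (- ?M2) ^ r"
    using power_diff_sumr2[of ?M1 r "- ?M2"] by simp
  then have "a * (?M1 + ?M2) dvd a * (?M1 ^ r - (- ?M2) ^ r)"
    by (intro mult_dvd_mono) auto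
  with dvd obtain c where c: "a * (?M1 ^ r - (- ?M2) ^ r) = p * c"
    by (meson dvdE dvd_trans)
  let ?W = "{x. \<exists>y\<in>keys a. ?w x = ?w y + int r * ?w m1}"
  \<comment> \<open>Multiplication by \<open>p\<close> raises weights by exactly \<open>d\<close>,
    so this splitting of \<open>c\<close> places \<open>p * c1\<close> inside \<open>?W\<close> and
    \<open>p * c2\<close> outside it.\<close>
  obtain c1 c2 where c12: "c = c1 + c2" "keys c1 \<subseteq> {x. \<exists>y\<in>keys a. d + ?w x = ?w y + int r * ?w m1}"
    "keys c2 \<subseteq> - {x. \<exists>y\<in>keys a. d + ?w x = ?w y + int r * ?w m1}"
    using ex_keys_split by blast
  have h1: "homogeneous N l (int r * ?w m1) (?M1 ^ r)"
    by (intro homogeneous_power homogeneous_single)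
  have h2: "homogeneous N l (int r * ?w m2) ((- ?M2) ^ r)"
    by (intro homogeneous_power homogeneous_minus homogeneous_single)
  have k1: "keys (a * ?M1 ^ r) \<subseteq> ?W"
    using keys_mult[of a "?M1 ^ r"] h1 by (fastforce simp: homogeneous_def weight_add)
  have k2: "keys (p * c1) \<subseteq> ?W"
    using keys_mult[of p c1] p c12(2) by (fastforce simp: homogeneous_def weight_add)
  have k3: "keys (a * (- ?M2) ^ r) \<subseteq> - ?W"
  proof
    fix x assume "x \<in> keys (a * (- ?M2) ^ r)"
    then obtain z where z: "z \<in> keys a" "?w x = ?w z + int r * ?w m2"
      using keys_mult[of a "(- ?M2) ^ r"] h2 by (auto simp: homogeneous_def weight_add)
    have "?w x \<noteq> ?w y + int r * ?w m1" if "y \<in> keys a" for y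
      using far[OF that z(1)] z(2) by simp
    then show "x \<in> - ?W" by simp
  qed
  have k4: "keys (p * c2) \<subseteq> - ?W"
    using keys_mult[of p c2] p c12(3) by (fastforce simp: homogeneous_def weight_add)
  have eq: "a * ?M1 ^ r - p * c1 = a * (- ?M2) ^ r + p * c2"
    using c by (simp add: c12(1) algebra_simps)
  have "keys (a * ?M1 ^ r - p * c1) \<subseteq> ?W"
    using keys_diff[of "a * ?M1 ^ r" "p * c1"] k1 k2 by blast
  moreover have "keys (a * ?M1 ^ r - p * c1) \<subseteq> - ?W"
    unfolding eq using Poly_Mapping.keys_add[of "a * (- ?M2) ^ r" "p * c2"] k3 k4 by blast
  ultimately have "a * ?M1 ^ r - p * c1 = 0"
    by (rule keys_disjoint_imp_zero)
  then have "p dvd a * ?M1 ^ r"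
    by (metis dvd_triv_left eq_iff_diff_eq_0)
  \<comment> \<open>The monomial \<open>?M1\<close> is a unit, so its power can be cancelled from
    the divisibility.\<close>
  moreover have "a * ?M1 ^ r * Poly_Mapping.single (- m1) 1 ^ r = a"
    by (simp add: mult.assoc mult_single flip: power_mult_distrib)
  ultimately show ?thesis
    by (metis dvd_mult2)
qed

lemma homogeneous_dvd_binomial_power_mult:
  fixes p :: laurent
  assumes "homogeneous N l d p"
    and "p dvd (Poly_Mapping.single m1 1 + Poly_Mapping.single m2 1) ^ k * a"
    and "weight N l m1 \<noteq> weight N l m2"
  shows "p dvd a"
  using assms(2)
proof (induction k)
  case (Suc k)
  let ?q = "Poly_Mapping.single m1 1 + Poly_Mapping.single m2 1 :: laurent"
  have "p dvd (?q ^ k * a) * ?q"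
    using Suc.prems by (simp only: power_Suc ac_simps)
  then have "p dvd ?q ^ k * a"
    by (rule homogeneous_dvd_binomial_mult[OF assms(1) _ assms(3)])
  then show ?case
    by (rule Suc.IH)
qed simp

text \<open>Comparing the two fractions for \<open>h\<close> gives a divisibility of
  \<open>q ^ l' * a\<close> by \<open>p ^ k\<close>. The power \<open>p ^ k\<close> is again
  homogeneous, so it divides the numerator \<open>a\<close> of \<open>h\<close>.\<close>

lemma coprime_localisations:
  assumes p: "homogeneous N l d p" "p \<noteq> 0"
    and q: "q = Poly_Mapping.single m1 1 + Poly_Mapping.single m2 1"
      "weight N l m1 \<noteq> weight N l m2"
    and h: "h \<in> localisation (to_fract p) laurents" "h \<in> localisation (to_fract q) laurents"
  shows "h \<in> laurents"
proof -
  obtain k a where a: "to_fract p ^ k * h = to_fract a"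
    using h(1) by (auto simp: localisation_def laurents_def)
  obtain l' b where b: "to_fract q ^ l' * h = to_fract b"
    using h(2) by (auto simp: localisation_def laurents_def)
  have "to_fract (q ^ l' * a) = to_fract q ^ l' * (to_fract p ^ k * h)"
    by (simp only: a to_fract_mult is_ring_hom_power[OF is_ring_hom_to_fract])
  also have "\<dots> = to_fract p ^ k * (to_fract q ^ l' * h)"
    by (rule mult.left_commute)
  also have "\<dots> = to_fract (p ^ k * b)"
    by (simp only: b to_fract_mult is_ring_hom_power[OF is_ring_hom_to_fract])
  finally have "to_fract (q ^ l' * a) = to_fract (p ^ k * b)" .
  then have "p ^ k dvd q ^ l' * a"
    by (metis dvd_triv_left to_fract_eq_iff)
  then have "p ^ k dvd a"
    unfolding q(1)
    by (rule homogeneous_dvd_binomial_power_mult[OF homogeneous_power[OF p(1)] _ q(2)])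
  then obtain c where "a = p ^ k * c" ..
  then have "to_fract p ^ k * h = to_fract p ^ k * to_fract c"
    using a by (simp add: is_ring_hom_power[OF is_ring_hom_to_fract])
  then have "h = to_fract c"
    using p(2) by simp
  then show ?thesis
    by (simp add: laurents_def)
qed

text \<open>Modulo \<open>p\<close> the element \<open>u + p * w\<close> is the unit
  \<open>u\<close>, so the two denominators generate the unit ideal of \<open>S\<close>.\<close>

lemma comaximal_localisations:
  fixes S :: "'a::field set"
  assumes S: "is_subring S" and u: "u \<in> S" "1 / u \<in> S" "u \<noteq> 0" and p: "p \<in> S" and w: "w \<in> S"
    and h: "h \<in> localisation p S" "h \<in> localisation (u + p * w) S"
  shows "h \<in> S"
proof -
  obtain l where l: "(u + p * w) ^ l * h \<in> S"
    using h(2) by (auto simp: localisation_def)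
  have "\<exists>v\<in>S. (u + p * w) ^ l = u ^ l + p * v" for l
  proof (induction l)
    case 0
    show ?case
      by (intro bexI[of _ 0]) (auto simp: is_subring_zero[OF S])
  next
    case (Suc l)
    then obtain v where v: "v \<in> S" "(u + p * w) ^ l = u ^ l + p * v" by blast
    show ?case
    proof (rule bexI[of _ "u * v + w * (u ^ l + p * v)"])
      show "(u + p * w) ^ Suc l = u ^ Suc l + p * (u * v + w * (u ^ l + p * v))"
        by (simp add: v(2) algebra_simps)
      show "u * v + w * (u ^ l + p * v) \<in> S"
        by (intro is_subring_add[OF S] is_subring_mult[OF S] is_subring_power[OF S] u p v(1) w)
    qed
  qed
  then obtain v where v: "v \<in> S" "(u + p * w) ^ l = u ^ l + p * v" by blast
  have "h \<in> S" if "p ^ k * h \<in> S" for k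
    using that
  proof (induction k)
    case (Suc k)
    let ?z = "p ^ k * h"
    \<comment> \<open>By the choice of \<open>v\<close> this difference is
      \<open>u ^ l * (p ^ k * h)\<close>; dividing by the unit lowers the exponent of
      \<open>p\<close> by one.\<close>
    have "p ^ k * ((u + p * w) ^ l * h) - v * (p ^ Suc k * h) \<in> S"
      by (intro is_subring_diff[OF S] is_subring_mult[OF S] is_subring_power[OF S] p l v(1) Suc.prems)
    then have "(1 / u) ^ l * (p ^ k * ((u + p * w) ^ l * h) - v * (p ^ Suc k * h)) \<in> S"
      by (intro is_subring_mult[OF S] is_subring_power[OF S] u)
    also have "(1 / u) ^ l * (p ^ k * ((u + p * w) ^ l * h) - v * (p ^ Suc k * h)) = ?z"
      unfolding v(2) using u(3) by (simp add: field_simps)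
    finally show ?case
      by (rule Suc.IH)
  qed simp
  then show ?thesis
    using h(1) by (auto simp: localisation_def)
qed

section \<open>Quivers and exchange polynomials\<close>

definition exchange_poly :: "nat \<Rightarrow> quiver \<Rightarrow> nat \<Rightarrow> laurent" where
  "exchange_poly N q j = (\<Prod>i\<in>{1..N}. var i ^ q i j) + (\<Prod>i\<in>{1..N}. var i ^ q j i)"

lemma is_quiverD:
  assumes "is_quiver N q"
  shows "q i i = 0" "q i j = 0 \<or> q j i = 0" "q i j \<noteq> 0 \<Longrightarrow> i \<in> {1..N}" "q i j \<noteq> 0 \<Longrightarrow> j \<in> {1..N}"
  using assms by (auto simp: is_quiver_def)

lemma is_quiver_mutate: "is_quiver N q \<Longrightarrow> is_quiver N (mutate_quiver a q)"
  unfolding is_quiver_def mutate_quiver_def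
proof (intro conjI allI impI; (elim conjE)?)
  fix i j
  assume supp: "\<forall>i j. q i j \<noteq> 0 \<longrightarrow> i \<in> {1..N} \<and> j \<in> {1..N}"
    and "pre_mutate a q i j - pre_mutate a q j i \<noteq> 0"
  then have "pre_mutate a q i j \<noteq> 0" by linarith
  then have "q j i \<noteq> 0 \<or> q i j \<noteq> 0 \<or> (q i a \<noteq> 0 \<and> q a j \<noteq> 0)"
    by (auto simp: pre_mutate_def split: if_splits)
  then show "i \<in> {1..N}" "j \<in> {1..N}"
    using supp by blast+
qed linarith+

lemma prod_var_power:
  "(\<Prod>i\<in>A. var i ^ e i) = Poly_Mapping.single (\<Sum>i\<in>A. Poly_Mapping.single i (int (e i))) 1"
proof -
  have "var i ^ k = var_power i (int k)" for i k
    by (induction k) (auto simp: var_power_0 var_power_add)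
  moreover have "(\<Prod>i\<in>A. var_power i (int (e i))) =
      Poly_Mapping.single (\<Sum>i\<in>A. Poly_Mapping.single i (int (e i))) 1"
    by (induction A rule: infinite_finite_induct) (auto simp: var_power_def mult_single)
  ultimately show ?thesis by simp
qed

lemma exchange_poly_nonzero: "exchange_poly N q j \<noteq> 0"
proof -
  note f = is_ring_hom_sum_coeffs
  have "sum_coeffs (exchange_poly N q j) = 2"
    by (simp add: exchange_poly_def is_ring_hom_simps[OF f] sum_coeffs_var_power)
  then show ?thesis
    using is_ring_hom_zero[OF f] by auto
qed

lemma prod_var_power_free_of: "e j = 0 \<Longrightarrow> (\<Prod>i\<in>A. var i ^ e i) \<in> free_of j"
  by (intro is_subring_prod[OF is_subring_free_of])
    (metis is_subring_one is_subring_free_of is_subring_power var_power_in_free_of power_0)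

lemma exchange_poly_free_of: "q i j = 0 \<Longrightarrow> q j i = 0 \<Longrightarrow> exchange_poly N q j \<in> free_of i"
  unfolding exchange_poly_def
  by (intro is_subring_add[OF is_subring_free_of] prod_var_power_free_of)

lemma exchange_pair_exchange_poly: "is_quiver N q \<Longrightarrow> exchange_pair j (exchange_poly N q j)"
  by unfold_locales (auto simp: exchange_poly_nonzero is_quiverD(1) exchange_poly_free_of)

lemma exchange_poly_mutate_self:
  assumes "is_quiver N q"
  shows "exchange_poly N (mutate_quiver a q) a = exchange_poly N q a"
proof -
  have "mutate_quiver a q i a = q a i" "mutate_quiver a q a i = q i a" for i
    using is_quiverD(2)[OF assms, of i a] by (auto simp: mutate_quiver_def pre_mutate_def)
  then show ?thesis
    by (simp add: exchange_poly_def)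
qed

definition opposite :: "quiver \<Rightarrow> quiver" where
  "opposite q i j = q j i"

lemma is_quiver_opposite: "is_quiver N q \<Longrightarrow> is_quiver N (opposite q)"
  by (auto simp: is_quiver_def opposite_def)

lemma exchange_poly_opposite: "exchange_poly N (opposite q) j = exchange_poly N q j"
  by (simp add: exchange_poly_def opposite_def)

lemma mutate_quiver_opposite: "mutate_quiver j (opposite q) = opposite (mutate_quiver j q)"
  by (auto simp: fun_eq_iff mutate_quiver_def pre_mutate_def opposite_def mult.commute)

text \<open>Linear independence of columns \<open>1\<close> to \<open>n\<close> of the signed
  exchange matrix. The row index \<open>i\<close> ranges over all naturals; for a quiver on
  \<open>N\<close> vertices the rows outside \<open>{1..N}\<close> are zero.\<close>

definition full_rank :: "nat \<Rightarrow> nat \<Rightarrow> quiver \<Rightarrow> bool" where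
  "full_rank N n q \<longleftrightarrow>
     (\<forall>c :: nat \<Rightarrow> int. (\<forall>i. (\<Sum>k\<in>{1..n}. c k * (int (q i k) - int (q k i))) = 0) \<longrightarrow>
        (\<forall>k\<in>{1..n}. c k = 0))"

text \<open>Matrix mutation is a combination of invertible row and column operations. Concretely, a
  relation \<open>c\<close> among the mutated columns is turned into a relation \<open>d\<close>
  among the original ones.\<close>

lemma full_rank_mutate:
  assumes q: "is_quiver N q" and rank: "full_rank N n q" and a: "a \<in> {1..n}"
  shows "full_rank N n (mutate_quiver a q)"
  unfolding full_rank_def
proof (intro allI impI)
  fix c :: "nat \<Rightarrow> int"
  let ?q' = "mutate_quiver a q"
  let ?V = "\<lambda>k i. int (q i k) - int (q k i)" and ?V' = "\<lambda>k i. int (?q' i k) - int (?q' k i)"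
  let ?A = "{1..n} - {a}"
  assume rel: "\<forall>i. (\<Sum>k\<in>{1..n}. c k * ?V' k i) = 0"
  have V': "?V' k i = int (pre_mutate a q i k) - int (pre_mutate a q k i)" for i k
    by (simp add: mutate_quiver_def)
  have V'a: "?V' a i = - ?V a i" "?V' k a = - ?V k a" for i k
    unfolding V' by (simp_all add: pre_mutate_def)
  have V'k: "?V' k i = ?V k i + int (q k a) * ?V a i + int (q i a) * ?V k a"
    if "k \<noteq> a" "i \<noteq> a" for i k
    unfolding V' using that by (simp add: pre_mutate_def algebra_simps)
  have split: "(\<Sum>k\<in>{1..n}. f k) = f a + (\<Sum>k\<in>?A. f k)" for f :: "nat \<Rightarrow> int"
    using a by (simp add: sum.remove)
  have rel_a: "(\<Sum>k\<in>?A. c k * ?V k a) = 0"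
    using rel[rule_format, of a] unfolding split V'a mult_minus_right sum_negf
    by (simp add: is_quiverD(1)[OF q])
  \<comment> \<open>Column \<open>a\<close> changes sign and is added \<open>q k a\<close> times to
    column \<open>k\<close>, which gives its new coefficient. The remaining terms, multiples of
    \<open>q i a\<close>, cancel by the relation in row \<open>a\<close>.\<close>
  define d where "d = (\<lambda>k. if k = a then (\<Sum>k\<in>?A. c k * int (q k a)) - c a else c k)"
  have "(\<Sum>k\<in>{1..n}. d k * ?V k i) = 0" for i
  proof -
    have d: "(\<Sum>k\<in>{1..n}. d k * ?V k i) =
        ((\<Sum>k\<in>?A. c k * int (q k a)) - c a) * ?V a i + (\<Sum>k\<in>?A. c k * ?V k i)"
      unfolding split by (simp add: d_def)
    show ?thesis
    proof (cases "i = a")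
      case True
      then show ?thesis
        using d rel_a by (simp add: is_quiverD(1)[OF q])
    next
      case False
      have "0 = c a * (- ?V a i) +
          (\<Sum>k\<in>?A. c k * (?V k i + int (q k a) * ?V a i + int (q i a) * ?V k a))"
        using rel[rule_format, of i] False unfolding split by (simp add: V'a V'k)
      also have "\<dots> = c a * (- ?V a i) + ((\<Sum>k\<in>?A. c k * ?V k i) +
          (\<Sum>k\<in>?A. c k * int (q k a)) * ?V a i + int (q i a) * (\<Sum>k\<in>?A. c k * ?V k a))"
        by (simp add: sum_distrib_left sum_distrib_right sum.distrib[symmetric] algebra_simps)
      finally show ?thesis
        using d rel_a by (simp add: algebra_simps)
    qed
  qed
  then have d0: "d k = 0" if "k \<in> {1..n}" for k
    using rank that unfolding full_rank_def by blast
  then have ck: "c k = 0" if "k \<in> ?A" for k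
    using that by (auto simp: d_def dest: spec[of _ k])
      (metis Diff_iff d_def singletonI)
  moreover have "c a = 0"
    using d0[OF a] ck by (simp add: d_def)
  ultimately show "\<forall>k\<in>{1..n}. c k = 0"
    by blast
qed

text \<open>The weight is a \<open>2 \<times> 2\<close> minor of the columns \<open>b\<close> and \<open>a\<close>, as a linear form in column \<open>a\<close>.\<close>

lemma full_rank_separating_weight:
  assumes q: "is_quiver N q" and rank: "full_rank N n q"
    and ab: "a \<in> {1..n}" "b \<in> {1..n}" "a \<noteq> b"
  obtains l :: "nat \<Rightarrow> int"
  where "(\<Sum>i\<in>{1..N}. l i * (int (q i b) - int (q b i))) = 0"
    "(\<Sum>i\<in>{1..N}. l i * (int (q i a) - int (q a i))) \<noteq> 0"
proof -
  let ?V = "\<lambda>k i. int (q i k) - int (q k i)"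
  have V0: "?V k i = 0" if "i \<notin> {1..N}" for k i
  proof -
    have "q i k = 0" "q k i = 0"
      using is_quiverD(3,4)[OF q] that by blast+
    then show ?thesis by simp
  qed
  have two: "(\<Sum>k\<in>{1..n}. c k * ?V k i) = c a * ?V a i + c b * ?V b i"
    if "\<And>k. k \<noteq> a \<Longrightarrow> k \<noteq> b \<Longrightarrow> c k = 0" for c :: "nat \<Rightarrow> int" and i
  proof -
    have "(\<Sum>k\<in>{1..n}. c k * ?V k i) = (\<Sum>k\<in>{a, b}. c k * ?V k i)"
      using ab that by (intro sum.mono_neutral_right) auto
    with ab(3) show ?thesis by simp
  qed
  have "\<exists>r s. ?V b r * ?V a s - ?V b s * ?V a r \<noteq> 0"
  proof (rule ccontr)
    assume "\<not> ?thesis"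
    then have minors: "?V b r * ?V a s - ?V b s * ?V a r = 0" for r s by blast
    have b0: "?V b r = 0" for r
    proof -
      \<comment> \<open>If all minors vanish, the entries of columns \<open>b\<close> and
        \<open>a\<close> in row \<open>r\<close> are, up to sign, the coefficients of a relation
        between these columns. Full rank forces the coefficient \<open>?V b r\<close> to be zero; as
        \<open>r\<close> is arbitrary, column \<open>b\<close> would be zero.\<close>
      let ?c = "\<lambda>k. if k = a then ?V b r else if k = b then - ?V a r else 0"
      have "(\<Sum>k\<in>{1..n}. ?c k * ?V k i) = 0" for i
        using two[of ?c i] minors[of r i] ab(3) by (simp add: algebra_simps)
      then have "\<forall>k\<in>{1..n}. ?c k = 0"
        using rank[unfolded full_rank_def, THEN spec[of _ ?c]] by blast
      from bspec[OF this ab(1)] show ?thesis by simp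
    qed
    let ?c = "\<lambda>k. if k = b then 1 else 0 :: int"
    have "(\<Sum>k\<in>{1..n}. ?c k * ?V k i) = 0" for i
      using two[of ?c i] b0[of i] ab(3) by simp
    then have "\<forall>k\<in>{1..n}. ?c k = 0"
      using rank[unfolded full_rank_def, THEN spec[of _ ?c]] by blast
    from bspec[OF this ab(2)] show False by simp
  qed
  then obtain r s where rs: "?V b r * ?V a s - ?V b s * ?V a r \<noteq> 0" by blast
  have r: "r \<in> {1..N}" and s: "s \<in> {1..N}"
    using rs V0 by fastforce+
  define l where "l = (\<lambda>i. (if i = s then ?V b r else 0) - (if i = r then ?V b s else 0))"
  have l: "(\<Sum>i\<in>{1..N}. l i * ?V k i) = ?V b r * ?V k s - ?V b s * ?V k r" for k
  proof -
    have "(\<Sum>i\<in>{1..N}. l i * ?V k i) =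
        (\<Sum>i\<in>{1..N}. (if i = s then ?V b r * ?V k i else 0)) -
        (\<Sum>i\<in>{1..N}. (if i = r then ?V b s * ?V k i else 0))"
      unfolding sum_subtractf[symmetric] by (intro sum.cong refl) (simp add: l_def algebra_simps)
    then show ?thesis
      using r s by (simp add: sum.delta)
  qed
  show thesis
    using that[of l] l[of a] l[of b] rs by simp
qed

lemma weight_monomial:
  "weight N l (\<Sum>i\<in>{1..N}. Poly_Mapping.single i (int (e i))) = (\<Sum>i\<in>{1..N}. l i * int (e i))"
  unfolding weight_def
  by (intro sum.cong refl arg_cong2[where f = "(*)"])
    (simp add: lookup_sum lookup_single when_def sum.delta)

text \<open>The weights of the two terms of the exchange polynomial at \<open>j\<close> differ by
  the value of \<open>l\<close> on column \<open>j\<close>. So the polynomial at \<open>b\<close> is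
  homogeneous and the one at \<open>a\<close> is a binomial with terms of different weights.\<close>

lemma full_rank_coprime:
  assumes q: "is_quiver N q" and rank: "full_rank N n q"
    and ab: "a \<in> {1..n}" "b \<in> {1..n}" "a \<noteq> b"
    and h: "h \<in> localisation (to_fract (exchange_poly N q b)) laurents"
      "h \<in> localisation (to_fract (exchange_poly N q a)) laurents"
  shows "h \<in> laurents"
proof -
  obtain l :: "nat \<Rightarrow> int" where
    l: "(\<Sum>i\<in>{1..N}. l i * (int (q i b) - int (q b i))) = 0"
      "(\<Sum>i\<in>{1..N}. l i * (int (q i a) - int (q a i))) \<noteq> 0"
    using full_rank_separating_weight[OF q rank ab] by blast
  let ?in = "\<lambda>j. \<Sum>i\<in>{1..N}. Poly_Mapping.single i (int (q i j))"
  let ?out = "\<lambda>j. \<Sum>i\<in>{1..N}. Poly_Mapping.single i (int (q j i))"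
  have exch: "exchange_poly N q j = Poly_Mapping.single (?in j) 1 + Poly_Mapping.single (?out j) 1" for j
    by (simp add: exchange_poly_def prod_var_power)
  have wt: "weight N l (?in j) - weight N l (?out j) =
      (\<Sum>i\<in>{1..N}. l i * (int (q i j) - int (q j i)))" for j
    unfolding weight_monomial right_diff_distrib sum_subtractf by (rule refl)
  have "homogeneous N l (weight N l (?in b)) (exchange_poly N q b)"
    unfolding exch using wt[of b] l(1)
    by (intro homogeneous_add homogeneous_single) (metis homogeneous_single eq_iff_diff_eq_0)
  moreover have "weight N l (?in a) \<noteq> weight N l (?out a)"
    using wt[of a] l(2) by auto
  ultimately show ?thesis
    using coprime_localisations[OF _ exchange_poly_nonzero exch _ h] by blast
qed

section \<open>Invariance of the upper bound under mutation\<close>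

lemma to_fract_prod_var_power:
  "to_fract (\<Prod>i\<in>A. var i ^ e i) = (\<Prod>i\<in>A. X i ^ e i)"
  by (simp add: is_ring_hom_simps[OF is_ring_hom_to_fract])

lemma monomial_in_laurents: "(\<Prod>i\<in>A. X i ^ e i) \<in> laurents" "1 / (\<Prod>i\<in>A. X i ^ e i) \<in> laurents"
proof -
  show "(\<Prod>i\<in>A. X i ^ e i) \<in> laurents"
    by (simp add: laurents_def flip: to_fract_prod_var_power)
  have "1 / (\<Prod>i\<in>A. X i ^ e i) = (\<Prod>i\<in>A. (1 / X i) ^ e i)"
    by (simp add: prod_dividef power_one_over)
  also have "\<dots> \<in> laurents"
    by (intro is_subring_prod[OF is_subring_laurents] is_subring_power[OF is_subring_laurents] X_in_laurents)
  finally show "1 / (\<Prod>i\<in>A. X i ^ e i) \<in> laurents" .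
qed

lemma monomial_nonzero: "(\<Prod>i\<in>A. X i ^ e i) \<noteq> 0"
  by (cases "finite A") (simp_all add: var_power_nonzero)

lemma to_fract_exchange_poly:
  "to_fract (exchange_poly N q j) = (\<Prod>i\<in>{1..N}. X i ^ q i j) + (\<Prod>i\<in>{1..N}. X i ^ q j i)"
  by (simp only: exchange_poly_def to_fract_add to_fract_prod_var_power)

text \<open>Reversing all arrows does not change the exchange polynomials, so it suffices to treat arrows
  from \<open>a\<close> to \<open>b\<close>. Up to a monomial, \<open>P'\<close> arises from \<open>P\<close> by replacing \<open>x\<^sub>a\<close> with \<open>u / x\<^sub>a\<close>, where
  \<open>u\<close> is the value at \<open>x\<^sub>b = 0\<close> of the exchange polynomial at \<open>a\<close>.\<close>

lemma adjacent_exchange_aux: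
  fixes \<Psi> :: "ratfun \<Rightarrow> ratfun"
  assumes q: "is_quiver N q" and ab: "a \<in> {1..N}" "b \<in> {1..N}" "a \<noteq> b"
    and c: "q a b = c" "c > 0"
  defines "\<Psi> \<equiv> \<lambda>z. flip b (exchange_poly N q b) (flip a (exchange_poly N q a) z)"
    and "G \<equiv> flip b (exchange_poly N q b) (to_fract (exchange_poly N q a))"
    and "P \<equiv> to_fract (exchange_poly N q b)"
    and "P' \<equiv> to_fract (exchange_poly N (mutate_quiver a q) b)"
  shows "\<exists>u w. u \<in> laurents \<and> 1 / u \<in> laurents \<and> u \<noteq> 0 \<and> w \<in> laurents \<and> G = u + P * w"
    and "\<exists>w\<in>laurents. \<Psi> P' = P * w"
proof -
  interpret fa: exchange_pair a "exchange_poly N q a"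
    by (rule exchange_pair_exchange_poly[OF q])
  interpret fb: exchange_pair b "exchange_poly N q b"
    by (rule exchange_pair_exchange_poly[OF q])
  note homb = fb.is_ring_hom_flip
  have hom: "is_ring_hom \<Psi>"
    unfolding \<Psi>_def by (rule is_ring_hom_compose[OF homb fa.is_ring_hom_flip])
  note L = is_subring_laurents
  let ?J = "{1..N} - {a, b}"
  have split: "(\<Prod>i\<in>{1..N}. f i) = f a * (f b * (\<Prod>i\<in>?J. f i))" for f :: "nat \<Rightarrow> ratfun"
  proof -
    have "(\<Prod>i\<in>{1..N}. f i) = f a * (\<Prod>i\<in>{1..N} - {a}. f i)"
      using ab by (intro prod.remove) auto
    also have "(\<Prod>i\<in>{1..N} - {a}. f i) = f b * (\<Prod>i\<in>{1..N} - {a} - {b}. f i)"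
      using ab by (intro prod.remove) auto
    also have "{1..N} - {a} - {b} = ?J" by auto
    finally show ?thesis .
  qed
  have q0: "q b a = 0" "q a a = 0" "q b b = 0"
    using is_quiverD(2)[OF q, of a b] c is_quiverD(1)[OF q] by auto
  let ?mon = "\<lambda>e. \<Prod>i\<in>?J. X i ^ e i"
  define In Out where "In = ?mon (\<lambda>i. q i b)" and "Out = ?mon (\<lambda>i. q b i)"
  define u D where "u = ?mon (\<lambda>i. q i a)" and "D = ?mon (\<lambda>i. q a i)"
  have u: "u \<in> laurents" "1 / u \<in> laurents" "u \<noteq> 0" and mons: "In \<in> laurents" "Out \<in> laurents" "D \<in> laurents"
    unfolding u_def In_def Out_def D_def by (rule monomial_in_laurents monomial_nonzero)+
  have P: "P = X a ^ c * In + Out"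
    unfolding P_def to_fract_exchange_poly split In_def Out_def by (simp add: q0 c)
  have Pa: "to_fract (exchange_poly N q a) = u + X b ^ c * D"
    unfolding to_fract_exchange_poly split u_def D_def by (simp add: q0 c)
  have \<Psi>b: "flip b (exchange_poly N q b) (?mon e) = ?mon e" for e
    unfolding is_ring_hom_prod[OF homb] is_ring_hom_power[OF homb] fb.flip_X
    by (intro prod.cong) auto
  have G: "G = u + (P / X b) ^ c * D"
    unfolding G_def Pa u_def D_def is_ring_hom_add[OF homb] is_ring_hom_mult[OF homb] \<Psi>b
      is_ring_hom_power[OF homb] fb.flip_X P_def by simp
  \<comment> \<open>By \<open>G\<close>, the difference of \<open>G\<close> and \<open>u\<close> is
    \<open>(P / X b) ^ c * D\<close>; as \<open>c > 0\<close>, one factor \<open>P\<close> can be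
    split off.\<close>
  define w where "w = P ^ (c - 1) * (1 / X b) ^ c * D"
  have PL: "P \<in> laurents"
    by (simp add: P_def laurents_def)
  have w: "w \<in> laurents"
    unfolding w_def by (intro is_subring_mult[OF L] is_subring_power[OF L] PL mons X_in_laurents)
  have "(P / X b) ^ c = P * (P ^ (c - 1) * (1 / X b) ^ c)"
    using c(2) by (cases c) (simp_all add: power_divide)
  then have Gw: "G = u + P * w"
    unfolding G w_def by (simp add: mult.assoc)
  then show "\<exists>u w. u \<in> laurents \<and> 1 / u \<in> laurents \<and> u \<noteq> 0 \<and> w \<in> laurents \<and> G = u + P * w"
    using u w by blast
  have GL: "G \<in> laurents"
    unfolding Gw by (intro is_subring_add[OF L] is_subring_mult[OF L] u PL w)
  let ?q' = "mutate_quiver a q"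
  have q'a: "?q' a b = 0" "?q' b a = c" "?q' b b = 0"
    using ab(3) by (auto simp: mutate_quiver_def pre_mutate_def q0 c)
  have \<Psi>X: "\<Psi> (X i) = (if i = a then G / X a else if i = b then P / X b else X i)" for i
    using ab(3) by (simp add: \<Psi>_def fa.flip_X fb.flip_X is_ring_hom_divide[OF homb] G_def P_def)
  have \<Psi>mon: "\<Psi> (?mon e) = ?mon e" for e
    unfolding is_ring_hom_prod[OF hom] is_ring_hom_power[OF hom] \<Psi>X
    by (intro prod.cong) auto
  have P': "\<Psi> P' = ?mon (\<lambda>i. ?q' i b) + (G / X a) ^ c * ?mon (\<lambda>i. ?q' b i)"
    unfolding P'_def to_fract_exchange_poly split is_ring_hom_add[OF hom] is_ring_hom_mult[OF hom]
      is_ring_hom_power[OF hom] \<Psi>mon \<Psi>X by (simp add: q'a)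
  \<comment> \<open>The monomial of the oriented 2-cycles that are cancelled in the mutated quiver.\<close>
  define M where "M = ?mon (\<lambda>i. min (q i b + q i a * c) (q b i))"
  have "?q' i b + min (q i b + q i a * c) (q b i) = q i b + c * q i a"
    "?q' b i + min (q i b + q i a * c) (q b i) = q b i" if "i \<in> ?J" for i
    using that ab(3) by (auto simp: mutate_quiver_def pre_mutate_def q0 c mult.commute min_def)
  then have "M * ?mon (\<lambda>i. ?q' i b) = ?mon (\<lambda>i. q i b + c * q i a)"
    and M2: "M * ?mon (\<lambda>i. ?q' b i) = Out"
    unfolding M_def Out_def prod.distrib[symmetric] power_add[symmetric]
    by (auto simp: add.commute intro!: prod.cong)
  moreover have "In * u ^ c = ?mon (\<lambda>i. q i b + c * q i a)"
    unfolding In_def u_def prod_power_distrib power_mult[symmetric] prod.distrib[symmetric]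
      power_add[symmetric] by (simp add: mult.commute)
  ultimately have M: "M * ?mon (\<lambda>i. ?q' i b) = In * u ^ c" by simp
  have "M * \<Psi> P' = In * u ^ c + (G / X a) ^ c * Out"
    unfolding P' distrib_left M M2[symmetric] by (simp add: ac_simps)
  then have *: "X a ^ c * M * \<Psi> P' = X a ^ c * In * u ^ c + G ^ c * Out"
    using X_nonzero[of a] by (simp add: field_simps power_divide)
  \<comment> \<open>Modulo \<open>P\<close>, the powers \<open>G ^ c\<close> and
    \<open>u ^ c\<close> agree, with cofactor \<open>w * S\<close>. The right-hand side of
    \<open>*\<close> thus becomes \<open>u ^ c * (X a ^ c * In + Out)\<close>, that is
    \<open>u ^ c * P\<close>, modulo \<open>P\<close>.\<close>
  define S where "S = (\<Sum>i<c. u ^ (c - Suc i) * G ^ i)"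
  have S: "S \<in> laurents"
    unfolding S_def by (intro is_subring_sum[OF L] is_subring_mult[OF L] is_subring_power[OF L] GL u)
  have "G ^ c - u ^ c = (G - u) * S"
    unfolding S_def by (rule power_diff_sumr2)
  then have Gc: "G ^ c = u ^ c + P * w * S"
    by (simp add: Gw algebra_simps)
  have "X a ^ c * M * \<Psi> P' = P * (u ^ c + w * S * Out)"
    unfolding * Gc by (simp add: P algebra_simps)
  then have "\<Psi> P' = P * ((1 / X a) ^ c * (1 / M) * (u ^ c + w * S * Out))"
    using X_nonzero[of a] monomial_nonzero[of _ ?J] by (simp add: field_simps M_def)
  moreover have "(1 / X a) ^ c * (1 / M) * (u ^ c + w * S * Out) \<in> laurents"
    unfolding M_def
    by (intro is_subring_add[OF L] is_subring_mult[OF L] is_subring_power[OF L] u w S mons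
        X_in_laurents monomial_in_laurents)
  ultimately show "\<exists>w\<in>laurents. \<Psi> P' = P * w"
    by blast
qed

text \<open>After the two flips, the variable obtained by mutating at \<open>a\<close> and then at
  \<open>b\<close> becomes this value divided by \<open>P / X b\<close>, where \<open>P\<close> is
  the exchange polynomial at \<open>b\<close>. The factor \<open>P\<close> cancels, leaving the
  Laurent polynomial \<open>w * X b\<close>.\<close>

lemma flip_exchange_partner:
  assumes q: "is_quiver N q" and ab: "a \<in> {1..N}" "b \<in> {1..N}" "a \<noteq> b"
  shows "\<exists>w\<in>laurents. flip b (exchange_poly N q b) (flip a (exchange_poly N q a)
      (to_fract (exchange_poly N (mutate_quiver a q) b))) = to_fract (exchange_poly N q b) * w"
proof -
  consider "q a b > 0" | "q b a > 0" | "q a b = 0" "q b a = 0" by blast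
  then show ?thesis
  proof cases
    case 1
    then show ?thesis
      using adjacent_exchange_aux(2)[OF q ab refl] by blast
  next
    case 2
    then have "opposite q a b > 0"
      by (simp add: opposite_def)
    from adjacent_exchange_aux(2)[OF is_quiver_opposite[OF q] ab refl this]
    show ?thesis
      by (simp only: exchange_poly_opposite mutate_quiver_opposite)
  next
    case 3
    have "mutate_quiver a q i b = q i b" "mutate_quiver a q b i = q b i" for i
      using is_quiverD(2)[OF q, of i b] 3 ab(3) by (auto simp: mutate_quiver_def pre_mutate_def)
    then have "exchange_poly N (mutate_quiver a q) b = exchange_poly N q b"
      by (simp add: exchange_poly_def)
    then show ?thesis
      using 3 exchange_pair.flip_free_of[OF exchange_pair_exchange_poly[OF q]]
        exchange_poly_free_of[of q a b] is_subring_one[OF is_subring_laurents]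
        exchange_pair.free[OF exchange_pair_exchange_poly[OF q]]
      by (intro bexI[of _ 1]) auto
  qed
qed

text \<open>For adjacent \<open>a\<close> and \<open>b\<close>, \<open>G\<close> is a Laurent unit
  modulo the exchange polynomial at \<open>b\<close>, so the two are comaximal. Otherwise the flip
  at \<open>b\<close> fixes the exchange polynomial at \<open>a\<close>, and coprimality comes from
  full rank.\<close>

lemma flip_exchange_poly_comaximal_or_coprime:
  assumes q: "is_quiver N q" and rank: "full_rank N n q" and "n \<le> N"
    and ab: "a \<in> {1..n}" "b \<in> {1..n}" "a \<noteq> b"
  defines "G \<equiv> flip b (exchange_poly N q b) (to_fract (exchange_poly N q a))"
  shows "G \<in> laurents"
    and "h \<in> localisation (to_fract (exchange_poly N q b)) laurents \<Longrightarrow> h \<in> localisation G laurents \<Longrightarrow>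
      h \<in> laurents"
proof -
  note L = is_subring_laurents
  have ab': "a \<in> {1..N}" "b \<in> {1..N}"
    using ab \<open>n \<le> N\<close> by auto
  let ?P = "to_fract (exchange_poly N q b)"
  have PL: "?P \<in> laurents"
    by (simp add: laurents_def)
  have adj: "\<exists>u w. u \<in> laurents \<and> 1 / u \<in> laurents \<and> u \<noteq> 0 \<and> w \<in> laurents \<and> G = u + ?P * w"
    if "q a b > 0 \<or> q b a > 0"
    using that
  proof
    assume "q a b > 0"
    then show ?thesis
      using adjacent_exchange_aux(1)[OF q ab' ab(3) refl] by (simp add: G_def)
  next
    assume "q b a > 0"
    then have "opposite q a b > 0"
      by (simp add: opposite_def)
    from adjacent_exchange_aux(1)[OF is_quiver_opposite[OF q] ab' ab(3) refl this]
    show ?thesis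
      by (simp only: exchange_poly_opposite G_def)
  qed
  have nonadj: "G = to_fract (exchange_poly N q a)" if "q a b = 0" "q b a = 0"
    unfolding G_def using that
    by (intro exchange_pair.flip_free_of[OF exchange_pair_exchange_poly[OF q]] exchange_poly_free_of)
  show "G \<in> laurents"
  proof (cases "q a b = 0 \<and> q b a = 0")
    case True
    then show ?thesis
      using nonadj by (simp add: laurents_def)
  next
    case False
    then show ?thesis
      using adj PL by (auto intro!: is_subring_add[OF L] is_subring_mult[OF L])
  qed
  show "h \<in> laurents" if h: "h \<in> localisation ?P laurents" "h \<in> localisation G laurents"
  proof (cases "q a b = 0 \<and> q b a = 0")
    case True
    then show ?thesis
      using full_rank_coprime[OF q rank ab h(1)] h(2) nonadj by simp
  next
    case False
    then obtain u w where uw: "u \<in> laurents" "1 / u \<in> laurents" "u \<noteq> 0" "w \<in> laurents" "G = u + ?P * w"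
      using adj by auto
    then show ?thesis
      using comaximal_localisations[OF L uw(1-3) PL uw(4) h(1)] h(2) by simp
  qed
qed

text \<open>Of the \<open>N\<close> vertices only the first \<open>n\<close> are mutable; frozen
  variables count as invertible. Being Laurent in a neighbouring cluster is tested by pulling back
  along the involution \<open>flip\<close>.\<close>

definition upper_bound :: "nat \<Rightarrow> nat \<Rightarrow> quiver \<Rightarrow> ratfun set" where
  "upper_bound N n q =
     {z \<in> laurents. \<forall>j\<in>{1..n}. flip j (exchange_poly N q j) z \<in> laurents}"

text \<open>The flip at \<open>a\<close> rewrites \<open>z\<close> from the mutated cluster to the
  initial one. In a direction \<open>b\<close> other than \<open>a\<close>, \<open>?\<Psi> z\<close>
  has a power of \<open>?P\<close> as denominator because \<open>?fa z\<close> is Laurent, and a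
  power of \<open>?G\<close> as denominator because \<open>z\<close> decomposes along the mutated
  seed in direction \<open>b\<close>. Together these leave no denominator.\<close>

lemma flip_upper_bound:
  assumes q: "is_quiver N q" and rank: "full_rank N n q" and "n \<le> N" and a: "a \<in> {1..n}"
    and z: "z \<in> upper_bound N n (mutate_quiver a q)"
  shows "flip a (exchange_poly N q a) z \<in> upper_bound N n q"
proof -
  let ?q' = "mutate_quiver a q"
  let ?fa = "flip a (exchange_poly N q a)"
  note q' = is_quiver_mutate[OF q, of a]
  note L = is_subring_laurents
  interpret fa: exchange_pair a "exchange_poly N q a"
    by (rule exchange_pair_exchange_poly[OF q])
  have zL: "z \<in> laurents" "?fa z \<in> laurents"
    using z a by (auto simp: upper_bound_def simp flip: exchange_poly_mutate_self[OF q, of a])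
  have "flip b (exchange_poly N q b) (?fa z) \<in> laurents" if b: "b \<in> {1..n}" "b \<noteq> a" for b
  proof -
    let ?P = "to_fract (exchange_poly N q b)"
    interpret fb: exchange_pair b "exchange_poly N q b"
      by (rule exchange_pair_exchange_poly[OF q])
    interpret fb': exchange_pair b "exchange_poly N ?q' b"
      by (rule exchange_pair_exchange_poly[OF q'])
    let ?\<Psi> = "\<lambda>z. flip b (exchange_poly N q b) (?fa z)"
    let ?G = "flip b (exchange_poly N q b) (to_fract (exchange_poly N q a))"
    note G = flip_exchange_poly_comaximal_or_coprime[OF q rank \<open>n \<le> N\<close> a b(1) b(2)[symmetric]]
    have ab': "a \<in> {1..N}" "b \<in> {1..N}"
      using a b \<open>n \<le> N\<close> by auto
    have hom: "is_ring_hom ?\<Psi>"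
      by (rule is_ring_hom_compose[OF fb.is_ring_hom_flip fa.is_ring_hom_flip])
    have \<Psi>X: "?\<Psi> (X i) = (if i = a then ?G / X a else if i = b then ?P / X b else X i)" for i
      using b(2) by (simp add: fa.flip_X fb.flip_X is_ring_hom_divide[OF fb.is_ring_hom_flip])
    have G0: "?G \<noteq> 0"
      by (simp add: is_ring_hom_eq_0_iff[OF fb.is_ring_hom_flip] exchange_poly_nonzero)
    let ?T = "localisation ?G laurents"
    have T: "is_subring ?T"
      by (rule is_subring_localisation[OF L G(1)])
    have LT: "x \<in> ?T" if "x \<in> laurents" for x
      using that localisation_superset by blast
    have gen: "?\<Psi> (X i) \<in> ?T" for i
    proof -
      have "?G * (1 / X a) \<in> laurents" "?P * (1 / X b) \<in> laurents"
        using is_subring_mult[OF L G(1) X_in_laurents(2)]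
          is_subring_mult[OF L _ X_in_laurents(2), of ?P] by (simp_all add: laurents_def)
      then show ?thesis
        unfolding \<Psi>X by (simp add: LT X_in_laurents)
    qed
    have inv: "1 / ?\<Psi> (X i) \<in> ?T" if "i \<noteq> b" for i
    proof (cases "i = a")
      case True
      have "X a * (1 / ?G) \<in> ?T"
        by (intro is_subring_mult[OF T] LT X_in_laurents inverse_in_localisation[OF L G0])
      with True show ?thesis by (simp add: \<Psi>X)
    next
      case False
      with that show ?thesis by (simp add: \<Psi>X LT X_in_laurents)
    qed
    have "flip b (exchange_poly N ?q' b) z \<in> laurents"
      using z b by (auto simp: upper_bound_def)
    then obtain e1 e2 where e: "e1 \<in> poly_in b" "e2 \<in> poly_in b"
      "z = to_fract e1 + flip b (exchange_poly N ?q' b) (to_fract e2)"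
      using fb'.laurent_both_decompose[OF zL(1)] by blast
    have 1: "?\<Psi> (to_fract e1) \<in> ?T"
      by (rule ratfun_hom_poly_in[OF hom T e(1) gen inv])
    let ?\<Psi>' = "\<lambda>z. ?\<Psi> (flip b (exchange_poly N ?q' b) z)"
    have hom': "is_ring_hom ?\<Psi>'"
      by (rule is_ring_hom_compose[OF hom fb'.is_ring_hom_flip])
    obtain w where w: "w \<in> laurents" "?\<Psi> (to_fract (exchange_poly N ?q' b)) = ?P * w"
      using flip_exchange_partner[OF q ab' b(2)[symmetric]] by blast
    have "?\<Psi>' (X b) = (?P * w) / (?P / X b)"
      using b(2) by (simp add: fb'.flip_X is_ring_hom_divide[OF hom] w(2) \<Psi>X)
    also have "\<dots> = w * X b"
      by (simp add: exchange_poly_nonzero)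
    finally have \<Psi>'b: "?\<Psi>' (X b) = w * X b" .
    have \<Psi>'X: "?\<Psi>' (X i) = ?\<Psi> (X i)" if "i \<noteq> b" for i
      using that by (simp add: fb'.flip_X)
    have 2: "?\<Psi>' (to_fract e2) \<in> ?T"
    proof (rule ratfun_hom_poly_in[OF hom' T e(2)])
      fix i
      show "?\<Psi>' (X i) \<in> ?T"
      proof (cases "i = b")
        case True
        show ?thesis
          unfolding True \<Psi>'b by (intro LT is_subring_mult[OF L] w(1) X_in_laurents)
      next
        case False
        then show ?thesis using gen \<Psi>'X by simp
      qed
      show "1 / ?\<Psi>' (X i) \<in> ?T" if "i \<noteq> b"
        unfolding \<Psi>'X[OF that] by (rule inv[OF that])
    qed
    have "?\<Psi> z = ?\<Psi> (to_fract e1) + ?\<Psi>' (to_fract e2)"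
      unfolding e(3) by (rule is_ring_hom_add[OF hom])
    then have "?\<Psi> z \<in> ?T"
      using is_subring_add[OF T 1 2] by simp
    moreover have "?\<Psi> z \<in> localisation ?P laurents"
      by (rule fb.flip_laurents_localisation[OF zL(2)])
    ultimately show ?thesis
      by (intro G(2))
  qed
  moreover have "flip a (exchange_poly N q a) (?fa z) \<in> laurents"
    using zL by (simp add: fa.flip_flip)
  ultimately have "flip b (exchange_poly N q b) (?fa z) \<in> laurents" if "b \<in> {1..n}" for b
    using that by (cases "b = a") auto
  then show ?thesis
    using zL by (simp add: upper_bound_def)
qed

section \<open>The Laurent phenomenon for quivers of full rank\<close>

lemma X_in_upper_bound:
  assumes q: "is_quiver N q"
  shows "X i \<in> upper_bound N n q"
proof -
  have "flip j (exchange_poly N q j) (X i) \<in> laurents" for j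
  proof -
    have "to_fract (exchange_poly N q j) * (1 / X j) \<in> laurents"
      by (intro is_subring_mult[OF is_subring_laurents] X_in_laurents) (simp add: laurents_def)
    then show ?thesis
      by (simp add: exchange_pair.flip_X[OF exchange_pair_exchange_poly[OF q]] X_in_laurents)
  qed
  then show ?thesis
    by (simp add: upper_bound_def X_in_laurents)
qed

lemma mutate_seed_hom:
  assumes f: "is_ring_hom f"
  shows "mutate_seed N j (map_prod id ((\<circ>) f) s) = map_prod id ((\<circ>) f) (mutate_seed N j s)"
  by (cases s) (auto simp: mutate_seed_def is_ring_hom_divide[OF f] is_ring_hom_simps[OF f] fun_eq_iff)

lemma fold_mutate_seed_hom:
  assumes f: "is_ring_hom f"
  shows "fold (mutate_seed N) js (map_prod id ((\<circ>) f) s) = map_prod id ((\<circ>) f) (fold (mutate_seed N) js s)"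
  by (induction js arbitrary: s) (simp_all add: mutate_seed_hom[OF f])

lemma mutate_seed_initial:
  assumes q: "is_quiver N q"
  shows "mutate_seed N a (q, X) = map_prod id ((\<circ>) (flip a (exchange_poly N q a))) (mutate_quiver a q, X)"
  by (auto simp: mutate_seed_def fun_eq_iff to_fract_exchange_poly
      exchange_pair.flip_X[OF exchange_pair_exchange_poly[OF q]])

text \<open>The first mutation yields the image under \<open>flip\<close> of the initial seed of the
  mutated quiver, and later mutations commute with this field homomorphism. The induction hypothesis
  for the mutated quiver is carried back by \<open>flip_upper_bound\<close>.\<close>

theorem cluster_variables_in_upper_bound:
  assumes "is_quiver N q" "full_rank N n q" "n \<le> N" "set js \<subseteq> {1..n}"
  shows "snd (fold (mutate_seed N) js (q, X)) i \<in> upper_bound N n q"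
  using assms
proof (induction js arbitrary: q)
  case Nil
  then show ?case
    by (simp add: X_in_upper_bound)
next
  case (Cons a js)
  note q = Cons.prems(1)
  have a: "a \<in> {1..n}"
    using Cons.prems(4) by simp
  let ?f = "flip a (exchange_poly N q a)"
  have f: "is_ring_hom ?f"
    by (rule exchange_pair.is_ring_hom_flip[OF exchange_pair_exchange_poly[OF q]])
  have "snd (fold (mutate_seed N) js (mutate_quiver a q, X)) i \<in> upper_bound N n (mutate_quiver a q)"
    using Cons.prems a by (intro Cons.IH is_quiver_mutate full_rank_mutate) auto
  then have "?f (snd (fold (mutate_seed N) js (mutate_quiver a q, X)) i) \<in> upper_bound N n q"
    using Cons.prems a by (intro flip_upper_bound) auto
  then show ?case
    by (simp add: mutate_seed_initial[OF q] fold_mutate_seed_hom[OF f] del: map_prod_simp)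
qed

lemma seeds_fold:
  assumes "s \<in> seeds n Q"
  shows "\<exists>js. set js \<subseteq> {1..n} \<and> s = fold (mutate_seed n) js (Q, X)"
  using assms
proof induction
  case initial
  show ?case by (intro exI[of _ "[]"]) simp
next
  case (mutation s j)
  then obtain js where "set js \<subseteq> {1..n}" "s = fold (mutate_seed n) js (Q, X)" by blast
  with mutation show ?case
    by (intro exI[of _ "js @ [j]"]) simp
qed

section \<open>Framed quivers\<close>

text \<open>The vertices outside \<open>{1..n}\<close> are frozen: mutations are never applied to them.\<close>

definition framed :: "nat \<Rightarrow> quiver \<Rightarrow> quiver" where
  "framed n Q i k = (if i \<in> {n + 1..2 * n} \<and> i = n + k then 1 else Q i k)"

lemma is_quiver_framed:
  assumes Q: "is_quiver n Q"
  shows "is_quiver (2 * n) (framed n Q)"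
proof -
  have out: "Q i k = 0" if "i > n \<or> k > n" for i k
    using is_quiverD(3,4)[OF Q, of i k] that by (metis atLeastAtMost_iff leD)
  show ?thesis
    unfolding is_quiver_def
  proof (intro conjI allI impI)
    fix i k
    show "framed n Q i i = 0"
      by (auto simp: framed_def is_quiverD(1)[OF Q])
    show "framed n Q i k = 0 \<or> framed n Q k i = 0"
      using is_quiverD(2)[OF Q, of i k] out[of k i] out[of i k] by (auto simp: framed_def)
    assume "framed n Q i k \<noteq> 0"
    then show "i \<in> {1..2 * n}" "k \<in> {1..2 * n}"
      using is_quiverD(3,4)[OF Q, of i k] by (auto simp: framed_def split: if_splits)
  qed
qed

text \<open>Row \<open>n + j\<close>, restricted to columns \<open>1\<close> to \<open>n\<close>, is
  the \<open>j\<close>-th unit vector, so a relation read in this row says that \<open>c j\<close>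
  vanishes.\<close>

lemma full_rank_framed:
  assumes Q: "is_quiver n Q"
  shows "full_rank (2 * n) n (framed n Q)"
  unfolding full_rank_def
proof (intro allI impI ballI)
  fix c :: "nat \<Rightarrow> int" and j
  assume rel: "\<forall>i. (\<Sum>k\<in>{1..n}. c k * (int (framed n Q i k) - int (framed n Q k i))) = 0"
    and j: "j \<in> {1..n}"
  have "Q (n + j) k = 0" "Q k (n + j) = 0" for k
    using is_quiverD(3,4)[OF Q, of "n + j" k] is_quiverD(3,4)[OF Q, of k "n + j"] j by auto
  then have "(\<Sum>k\<in>{1..n}. c k * (int (framed n Q (n + j) k) - int (framed n Q k (n + j)))) =
      (\<Sum>k\<in>{1..n}. if k = j then c k else 0)"
    using j by (intro sum.cong refl) (auto simp: framed_def)
  also have "\<dots> = c j"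
    using j by simp
  finally show "c j = 0"
    using rel by simp
qed

definition unframe :: "nat \<Rightarrow> laurent \<Rightarrow> laurent" where
  "unframe n = eval_laurent (\<lambda>i k. if i \<in> {1..n} then var_power i k else 1)"

lemma exponential_unframe: "exponential (\<lambda>i k. if i \<in> {1..n} then var_power i k else 1)"
  unfolding exponential_def
proof (intro allI conjI)
  fix i a b
  let ?g = "\<lambda>i k. if i \<in> {1..n} then var_power i k else 1"
  show "?g i (a + b) = ?g i a * ?g i b"
    by (cases "i \<in> {1..n}") (simp_all only: if_True if_False var_power_add mult_1_left)
qed (simp add: var_power_0)

lemma is_ring_hom_unframe: "is_ring_hom (unframe n)"
  unfolding unframe_def by (rule is_ring_hom_eval_laurent[OF exponential_unframe])

lemma unframe_var_power: "unframe n (var_power i k) = (if i \<in> {1..n} then var_power i k else 1)"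
  unfolding unframe_def by (rule eval_laurent_var_power[OF exponential_unframe])

lemma sum_coeffs_unframe: "sum_coeffs (unframe n p) = sum_coeffs p"
proof -
  have "sum_coeffs (unframe n p) = eval_laurent (\<lambda>i k. sum_coeffs (unframe n (var_power i k))) p"
    by (rule ring_hom_eq_eval_laurent[OF is_ring_hom_compose[OF is_ring_hom_sum_coeffs is_ring_hom_unframe]])
  also have "(\<lambda>i k. sum_coeffs (unframe n (var_power i k))) = (\<lambda>i k. 1)"
    by (simp add: fun_eq_iff unframe_var_power sum_coeffs_var_power is_ring_hom_one[OF is_ring_hom_sum_coeffs])
  finally show ?thesis
    by (simp add: sum_coeffs_def)
qed

text \<open>Positivity of the sum of the coefficients guarantees that no cluster variable becomes zero
  when the frozen variables are set to 1.\<close>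

lemma unframe_seed:
  assumes Q: "is_quiver n Q" and js: "set js \<subseteq> {1..n}"
  defines "s \<equiv> fold (mutate_seed (2 * n)) js (framed n Q, X)" and "s0 \<equiv> fold (mutate_seed n) js (Q, X)"
  shows "(\<forall>i\<in>{1..n}. \<forall>k\<in>{1..n}. fst s i k = fst s0 i k) \<and>
    (\<exists>p. (\<forall>i. snd s i = to_fract (p i) \<and> sum_coeffs (p i) > 0) \<and> (\<forall>i. i \<notin> {1..n} \<longrightarrow> p i = var i) \<and>
       (\<forall>i\<in>{1..n}. snd s0 i = to_fract (unframe n (p i))))"
  using js unfolding s_def s0_def
proof (induction js rule: rev_induct)
  case Nil
  have "framed n Q i k = Q i k" if "i \<in> {1..n}" for i k
    using that by (simp add: framed_def)
  then show ?case
    by (auto intro!: exI[of _ var] simp: unframe_var_power sum_coeffs_var_power)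
next
  case (snoc j js)
  have j: "j \<in> {1..n}" and js: "set js \<subseteq> {1..n}"
    using snoc.prems by auto
  obtain q c where qc: "fold (mutate_seed (2 * n)) js (framed n Q, X) = (q, c)" by fastforce
  obtain q0 c0 where qc0: "fold (mutate_seed n) js (Q, X) = (q0, c0)" by fastforce
  obtain p where eq: "\<And>i k. i \<in> {1..n} \<Longrightarrow> k \<in> {1..n} \<Longrightarrow> q i k = q0 i k"
    and c: "\<And>i. c i = to_fract (p i)" and pos: "\<And>i. sum_coeffs (p i) > 0"
    and frozen: "\<And>i. i \<notin> {1..n} \<Longrightarrow> p i = var i"
    and c0: "\<And>i. i \<in> {1..n} \<Longrightarrow> c0 i = to_fract (unframe n (p i))"
    using snoc.IH[OF js] by (auto simp: qc qc0)
  note hs = is_ring_hom_sum_coeffs and hu = is_ring_hom_unframe[of n] and ht = is_ring_hom_to_fract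
  have p0: "p i \<noteq> 0" "unframe n (p i) \<noteq> 0" for i
    using pos[of i] sum_coeffs_unframe[of n "p i"] is_ring_hom_zero[OF hs] by auto
  define e where "e = (\<Prod>i\<in>{1..2 * n}. p i ^ q i j) + (\<Prod>i\<in>{1..2 * n}. p i ^ q j i)"
  have step: "fold (mutate_seed (2 * n)) (js @ [j]) (framed n Q, X) =
      (mutate_quiver j q, c(j := to_fract e / to_fract (p j)))"
    by (simp add: qc mutate_seed_def e_def c is_ring_hom_simps[OF ht])
  \<comment> \<open>The Laurent phenomenon for the framed quiver makes the new variable a Laurent
    polynomial \<open>p'\<close>, to which \<open>unframe\<close> can be applied.\<close>
  have "snd (fold (mutate_seed (2 * n)) (js @ [j]) (framed n Q, X)) j \<in> laurents"
    using cluster_variables_in_upper_bound[OF is_quiver_framed[OF Q] full_rank_framed[OF Q] _ snoc.prems]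
    by (auto simp: upper_bound_def)
  then obtain p' where p': "to_fract e / to_fract (p j) = to_fract p'"
    unfolding step by (auto simp: laurents_def)
  then have "to_fract e = to_fract (p' * p j)"
    using p0(1)[of j] by (simp add: divide_eq_eq)
  then have e: "p' * p j = e"
    unfolding to_fract_eq_iff by simp
  have "sum_coeffs e > 0"
    unfolding e_def is_ring_hom_simps[OF hs]
    by (intro add_pos_pos prod_pos) (simp_all add: pos)
  then have pos': "sum_coeffs p' > 0"
    using pos[of j] unfolding e[symmetric] is_ring_hom_mult[OF hs] by (simp add: zero_less_mult_iff)
  have restrict: "(\<Prod>i\<in>{1..2 * n}. unframe n (p i) ^ f i) = (\<Prod>i\<in>{1..n}. unframe n (p i) ^ f i)" for f
    by (rule prod.mono_neutral_right) (auto simp: frozen unframe_var_power)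
  have "unframe n p' * unframe n (p j) =
      (\<Prod>i\<in>{1..n}. unframe n (p i) ^ q0 i j) + (\<Prod>i\<in>{1..n}. unframe n (p i) ^ q0 j i)"
    unfolding is_ring_hom_mult[OF hu, symmetric] e e_def is_ring_hom_simps[OF hu] restrict
    using j by (intro arg_cong2[where f = "(+)"] prod.cong refl) (simp_all add: eq)
  moreover have "to_fract (\<Prod>i\<in>{1..n}. unframe n (p i) ^ f i) = (\<Prod>i\<in>{1..n}. c0 i ^ f i)" for f
    unfolding is_ring_hom_simps[OF ht] by (intro prod.cong refl) (simp add: c0)
  ultimately have "to_fract (unframe n p') * to_fract (unframe n (p j)) =
      (\<Prod>i\<in>{1..n}. c0 i ^ q0 i j) + (\<Prod>i\<in>{1..n}. c0 i ^ q0 j i)"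
    unfolding to_fract_mult[symmetric] by (simp only: to_fract_add)
  then have "((\<Prod>i\<in>{1..n}. c0 i ^ q0 i j) + (\<Prod>i\<in>{1..n}. c0 i ^ q0 j i)) / c0 j =
      to_fract (unframe n p')"
    using p0(2)[of j] by (simp add: c0[OF j] divide_eq_eq)
  then have step0: "fold (mutate_seed n) (js @ [j]) (Q, X) =
      (mutate_quiver j q0, c0(j := to_fract (unframe n p')))"
    by (simp add: qc0 mutate_seed_def)
  have "\<forall>i\<in>{1..n}. \<forall>k\<in>{1..n}. mutate_quiver j q i k = mutate_quiver j q0 i k"
    using j by (auto simp: mutate_quiver_def pre_mutate_def eq)
  then show ?case
    unfolding step step0 p' fst_conv snd_conv
    using j c pos frozen c0 pos' by (intro conjI exI[of _ "p(j := p')"]) auto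
qed

section \<open>Specialisation to a single free variable\<close>

theorem corollary1:
  fixes n :: nat and Q :: quiver
  assumes "is_quiver n Q"
    and "\<exists>j\<in>{1..n}. \<exists>k\<in>{1..n}. odd (Q j k + Q k j)"
  shows "\<exists>\<sigma>. is_specialisation n \<sigma> \<and>
           polyamorous n Q \<sigma> \<and>
           free_indices n \<sigma> \<noteq> {} \<and>
           specialised_cluster_algebra n Q \<sigma> = subring_generated (var ` free_indices n \<sigma>)"
proof -
  note Q = assms(1)
  obtain j k where j: "j \<in> {1..n}" and k: "k \<in> {1..n}" and odd: "odd (Q j k + Q k j)"
    using assms(2) by blast
  have jk: "j \<noteq> k"
    using odd by auto
  define \<sigma> where "\<sigma> = (\<lambda>i. if i \<in> {1..n} - {j} then Some (if i = k then - 1 else 1 :: int) else None)"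
  have \<sigma>: "is_specialisation n \<sigma>"
    by (auto simp: is_specialisation_def \<sigma>_def ran_def split: if_splits)
  have free: "free_indices n \<sigma> = {j}"
    using j by (auto simp: free_indices_def \<sigma>_def split: if_splits)
  let ?R = "subring_generated {var j}"
  have R: "is_subring ?R"
    by (rule is_subring_subring_generated)
  let ?\<rho> = "\<lambda>p. specialise \<sigma> (unframe n p)"
  have hom\<sigma>: "is_ring_hom (specialise \<sigma>)"
    by (rule is_ring_hom_specialise[OF \<sigma>])
  have hom: "is_ring_hom ?\<rho>"
    by (rule is_ring_hom_compose[OF hom\<sigma> is_ring_hom_unframe])
  have \<rho>_var: "?\<rho> (var_power i m) =
      (if i = j then var_power j m else if i = k then (- 1) ^ nat \<bar>m\<bar> else 1)" for i m
  proof -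
    have "specialise \<sigma> (var_power i m) = (if i \<in> {1..n} - {j}
        then if i = k then (- 1) ^ nat \<bar>m\<bar> else 1 else var_power i m)"
      unfolding specialise_var_power[OF \<sigma>] by (auto simp: specialise_power_def \<sigma>_def)
    moreover have "i \<noteq> j" "i \<noteq> k" if "i \<notin> {1..n}"
      using that j k by auto
    ultimately show ?thesis
      unfolding unframe_var_power by (cases "i \<in> {1..n}") (simp_all add: is_ring_hom_one[OF hom\<sigma>])
  qed
  let ?F = "framed n Q" and ?P = "exchange_poly (2 * n) (framed n Q) j"
  \<comment> \<open>Apart from \<open>x_j\<close>, which has exponent zero here, only
    \<open>x_k\<close> is sent to a value other than 1.\<close>
  have \<rho>_prod: "(\<Prod>i\<in>{1..2 * n}. ?\<rho> (var i) ^ f i) = (- 1) ^ f k" if "f j = 0" for f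
  proof -
    have "(\<Prod>i\<in>{1..2 * n}. ?\<rho> (var i) ^ f i) = (\<Prod>i\<in>{k}. ?\<rho> (var i) ^ f i)"
      using k that by (intro prod.mono_neutral_right) (auto simp: \<rho>_var)
    then show ?thesis
      using jk by (simp add: \<rho>_var)
  qed
  have "?\<rho> ?P = (- 1) ^ ?F k j + (- 1) ^ ?F j k"
    unfolding exchange_poly_def is_ring_hom_simps[OF hom]
    by (intro arg_cong2[where f = "(+)"] \<rho>_prod is_quiverD(1)[OF is_quiver_framed[OF Q]])
  \<comment> \<open>Framing leaves the arrows between \<open>j\<close> and \<open>k\<close>
    unchanged. The two exponents have odd sum, so the signs are opposite.\<close>
  also have "\<dots> = 0"
    using odd j k by (auto simp: framed_def)
  finally have \<rho>_exchange: "?\<rho> ?P = 0" .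
  have upper: "?\<rho> p \<in> ?R" if p: "to_fract p \<in> upper_bound (2 * n) n ?F" for p
  proof -
    interpret exchange_pair j ?P
      by (rule exchange_pair_exchange_poly[OF is_quiver_framed[OF Q]])
    \<comment> \<open>\<open>?\<rho>\<close> is defined only on Laurent polynomials. The condition
      that the image lies in \<open>?R\<close> is therefore stated as membership in a subring of the
      field, to which \<open>ratfun_hom_poly_in\<close> applies.\<close>
    let ?S = "to_fract ` (?\<rho> -` ?R)"
    have S: "is_subring ?S"
      by (intro is_subring_image[OF is_ring_hom_to_fract] is_subring_vimage[OF hom] R)
    have in_S: "X i powi m \<in> ?S" if "i \<noteq> j \<or> m = 1" for i m
      unfolding X_powi using that
      by (intro imageI) (auto simp: \<rho>_var intro!: subring_generated.base is_subring_one[OF R]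
          is_subring_power[OF R] is_subring_minus[OF R])
    have X_in_S: "X i \<in> ?S" for i
      using in_S[of i 1] by simp
    have inv_in_S: "1 / X i \<in> ?S" if "i \<noteq> j" for i
      using in_S[of i "-1"] that unfolding X_powi inverse_X by blast
    obtain e1 e2 where e: "e1 \<in> poly_in j" "e2 \<in> poly_in j"
      "to_fract p = to_fract e1 + flip j ?P (to_fract e2)"
      using laurent_both_decompose[of "to_fract p"] p j by (auto simp: upper_bound_def)
    have "to_fract e1 \<in> ?S"
      by (rule ratfun_hom_poly_in[OF is_ring_hom_id S e(1) X_in_S inv_in_S])
    moreover have "flip j ?P (to_fract e2) \<in> ?S"
    proof (rule ratfun_hom_poly_in[OF is_ring_hom_flip S e(2)])
      fix i
      have eq: "to_fract ?P / X j = to_fract (?P * var_power j (- 1))"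
        using inverse_X[of j] by (simp add: divide_inverse)
      \<comment> \<open>Here the vanishing of the exchange polynomial enters:
        \<open>?P / x_j\<close> specialises to 0 although \<open>1 / x_j\<close> does not specialise
        into \<open>?R\<close>.\<close>
      have "to_fract ?P / X j \<in> ?S"
        unfolding eq
        by (intro imageI) (simp add: is_ring_hom_mult[OF hom] \<rho>_exchange is_subring_zero[OF R])
      then show "flip j ?P (X i) \<in> ?S"
        using X_in_S by (simp add: flip_X)
      show "1 / flip j ?P (X i) \<in> ?S" if "i \<noteq> j"
        using inv_in_S[OF that] that by (simp add: flip_X)
    qed
    ultimately have "to_fract p \<in> ?S"
      unfolding e(3) by (rule is_subring_add[OF S])
    then show ?thesis by auto
  qed
  have sub: "specialised_cluster_algebra n Q \<sigma> \<subseteq> ?R"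
  proof -
    let ?S = "to_fract ` (specialise \<sigma> -` ?R)"
    have S: "is_subring ?S"
      by (intro is_subring_image[OF is_ring_hom_to_fract] is_subring_vimage[OF hom\<sigma>] R)
    have "c i \<in> ?S" if s: "(q, c) \<in> seeds n Q" and i: "i \<in> {1..n}" for q c i
    proof -
      obtain js where js: "set js \<subseteq> {1..n}" "(q, c) = fold (mutate_seed n) js (Q, X)"
        using seeds_fold[OF s] by blast
      let ?s = "fold (mutate_seed (2 * n)) js (framed n Q, X)"
      obtain p where p: "snd ?s i = to_fract p" "c i = to_fract (unframe n p)"
        using unframe_seed[OF Q js(1)] i by (auto simp flip: js(2))
      have "snd ?s i \<in> upper_bound (2 * n) n ?F"
        by (rule cluster_variables_in_upper_bound[OF is_quiver_framed[OF Q] full_rank_framed[OF Q] _ js(1)]) simp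
      then have "?\<rho> p \<in> ?R"
        unfolding p(1) by (rule upper)
      then show ?thesis
        unfolding p(2) by blast
    qed
    then have "cluster_algebra n Q \<subseteq> ?S"
      unfolding cluster_algebra_def by (intro subring_generated_subset S) auto
    then show ?thesis
      by (force simp: specialised_cluster_algebra_def)
  qed
  moreover have "?R \<subseteq> specialised_cluster_algebra n Q \<sigma>"
  proof (rule subring_generated_subset)
    show "is_subring (specialised_cluster_algebra n Q \<sigma>)"
      unfolding specialised_cluster_algebra_def cluster_algebra_def
      by (intro is_subring_image[OF hom\<sigma>] is_subring_vimage[OF is_ring_hom_to_fract]
          is_subring_subring_generated)
    have "X j \<in> cluster_algebra n Q"
      unfolding cluster_algebra_def
    proof (rule subring_generated.base, rule CollectI, intro exI conjI)
      show "X j = (\<lambda>i. X i) j" by simp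
    qed (rule seeds.initial, rule j)
    moreover have "specialise \<sigma> (var j) = var j"
      unfolding specialise_var_power[OF \<sigma>] by (simp add: specialise_power_def \<sigma>_def)
    ultimately show "{var j} \<subseteq> specialised_cluster_algebra n Q \<sigma>"
      unfolding specialised_cluster_algebra_def by (auto intro!: image_eqI[of _ _ "var j"])
  qed
  ultimately have eq: "specialised_cluster_algebra n Q \<sigma> = ?R"
    by blast
  have "?R \<subseteq> poly_in j"
    by (rule subring_generated_subset[OF is_subring_poly_in]) (simp add: var_power_in_poly_in)
  then have "polyamorous n Q \<sigma>"
    by (auto simp: polyamorous_def polyamorous_var_def free eq poly_in_def)
  with \<sigma> eq show ?thesis
    by (intro exI[of _ \<sigma>]) (simp add: free)
qed

end
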